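(* Let $H\colon\mathbb{R}^n\to\mathbb{R}^n$ and let $\bar x\in\mathbb{R}^n$ be a solution of $H(x)=0$. Suppose that $H$ is locally Lipschitzian and directionally differentiable around $\bar x$, semismooth at $\bar x$, one-to-one around $\bar x$, and metrically regular around $\bar x$, i.e., $$0\in\partial\langle z,H\rangle(\bar x)\ \Longrightarrow\ z=0.$$ Then, for every starting point $x^0$ sufficiently close to $\bar x$, the $B$-differentiable Newton method $$-H(x^k)=H'(x^k;d^k),\qquad x^{k+1}:=x^k+d^k,\quad k=0,1,2,\ldots,$$ is well defined (meaning that the equation $-H(x^k)=H'(x^k;d^k)$ is solvable for $d^k$ at each $k$) and converges at least superlinearly to the solution $\bar x$.
   Context: $H'(x;d)$ is the classical (one-sided) directional derivative $\lim_{t\downarrow0}(H(x+td)-H(x))/t$. In the method, $d^k$ is any solution of the displayed equation. "At least superlinearly" means $x^k\to\bar x$ and $\|x^{k+1}-\bar x\|=o(\|x^k-\bar x\|)$. "One-to-one around $\bar x$" means injective on some neighborhood of $\bar x$. Semismoothness: a mapping $H$, locally Lipschitzian and directionally differentiable around $\bar x$, is semismooth at $\bar x$ if for every $z\in\mathbb{R}^n$ the limit $\lim\{Ah:\ A\in\partial_CH(\bar x+th),\ h\to z,\ t\downarrow0\}$ exists. Here $\partial_CH(x)$ is Clarke's generalized Jacobian, the convex hull of $\partial_BH(x)=\{\lim_kH'(x^k): x^k\to x,\ H \text{ differentiable at } x^k\}$. Metric regularity: $H$ is metrically regular around $\bar x$ if there are neighborhoods $U$ of $\bar x$ and $V$ of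 $H(\bar x)$ and $\mu>0$ such that $\mathrm{dist}(x;H^{-1}(y))\le\mu\|y-H(x)\|$ for all $x\in U$, $y\in V$ (with $\mathrm{dist}(x;\emptyset)=\infty$). For locally Lipschitzian $H$ the displayed implication is a known equivalent characterization of this property. Limiting subdifferential: $\langle z,H\rangle$ is the function $x\mapsto\sum_iz_iH_i(x)$; for $f\colon\mathbb{R}^n\to\mathbb{R}$ continuous around $\bar x$, $\partial f(\bar x)$ is the set of limits of sequences $p_k\in\hat\partial f(x_k)$ with $x_k\to\bar x$, where $\hat\partial f(x)=\{p:\liminf_{u\to x}\frac{f(u)-f(x)-\langle p,u-x\rangle}{\|u-x\|}\ge0\}$. *)

theory Defs
  imports "HOL-Analysis.Analysis" "HOL-Library.Landau_Symbols"
begin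

definition lipschitz_around :: "('a::metric_space \<Rightarrow> 'b::metric_space) \<Rightarrow> 'a \<Rightarrow> bool" where
  "lipschitz_around H xbar \<longleftrightarrow> (\<exists>U L. open U \<and> xbar \<in> U \<and> L-lipschitz_on U H)"

definition one_to_one_around :: "('a::topological_space \<Rightarrow> 'b) \<Rightarrow> 'a \<Rightarrow> bool" where
  "one_to_one_around H xbar \<longleftrightarrow> (\<exists>U. open U \<and> xbar \<in> U \<and> inj_on H U)"

text \<open>\<open>has_dir_deriv H x d v\<close> says that the one-sided directional derivative
  \<open>H'(x;d)\<close> exists and equals \<open>v\<close>.\<close>

definition has_dir_deriv ::
    "('a::real_normed_vector \<Rightarrow> 'b::real_normed_vector) \<Rightarrow> 'a \<Rightarrow> 'a \<Rightarrow> 'b \<Rightarrow> bool" where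
  "has_dir_deriv H x d v \<longleftrightarrow>
     ((\<lambda>t. (H (x + t *\<^sub>R d) - H x) /\<^sub>R t) \<longlongrightarrow> v) (at_right 0)"

definition dir_differentiable_around ::
    "('a::real_normed_vector \<Rightarrow> 'b::real_normed_vector) \<Rightarrow> 'a \<Rightarrow> bool" where
  "dir_differentiable_around H xbar \<longleftrightarrow>
     (\<exists>U. open U \<and> xbar \<in> U \<and> (\<forall>x\<in>U. \<forall>d. \<exists>v. has_dir_deriv H x d v))"

definition B_subdifferential :: "(real^'n \<Rightarrow> real^'m) \<Rightarrow> real^'n \<Rightarrow> (real^'n^'m) set" where
  "B_subdifferential H x =
     {A. \<exists>X. X \<longlonglongrightarrow> x \<and> (\<forall>k. H differentiable (at (X k))) \<and>
             (\<lambda>k. jacobian H (at (X k))) \<longlonglongrightarrow> A}"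

definition clarke_jacobian :: "(real^'n \<Rightarrow> real^'m) \<Rightarrow> real^'n \<Rightarrow> (real^'n^'m) set" where
  "clarke_jacobian H x = convex hull (B_subdifferential H x)"

text \<open>Only the limit condition of semismoothness; the Lipschitz and directional
  differentiability requirements are stated separately. The limit is that of a
  set-valued expression, hence uniform in the choice of \<open>A\<close>; the direction \<open>h\<close>
  tends to \<open>z\<close> with \<open>h = z\<close> allowed.\<close>

definition semismooth_at :: "(real^'n \<Rightarrow> real^'m) \<Rightarrow> real^'n \<Rightarrow> bool" where
  "semismooth_at H xbar \<longleftrightarrow>
     (\<forall>z. \<exists>l. \<forall>e>0. \<forall>\<^sub>F (h, t) in nhds z \<times>\<^sub>F at_right 0.
        \<forall>A\<in>clarke_jacobian H (xbar + t *\<^sub>R h). dist (A *v h) l < e)"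

text \<open>The distance to a set is taken in the extended reals, so that the distance to the
  empty set is \<open>\<infinity>\<close> (unlike \<open>infdist\<close>, which is then \<open>0\<close>).\<close>

definition set_dist :: "'a::metric_space \<Rightarrow> 'a set \<Rightarrow> ereal" where
  "set_dist x S = (INF u\<in>S. ereal (dist x u))"

definition metrically_regular_around ::
    "('a::metric_space \<Rightarrow> 'b::real_normed_vector) \<Rightarrow> 'a \<Rightarrow> bool" where
  "metrically_regular_around H xbar \<longleftrightarrow>
     (\<exists>U V. \<exists>\<mu>>0. open U \<and> xbar \<in> U \<and> open V \<and> H xbar \<in> V \<and>
        (\<forall>x\<in>U. \<forall>y\<in>V. set_dist x (H -` {y}) \<le> ereal (\<mu> * norm (y - H x))))"

definition regular_subdifferential :: "('a::real_inner \<Rightarrow> real) \<Rightarrow> 'a \<Rightarrow> 'a set" where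
  "regular_subdifferential f x =
     {p. Liminf (at x) (\<lambda>u. ereal ((f u - f x - p \<bullet> (u - x)) / norm (u - x))) \<ge> 0}"

text \<open>Intended for functions continuous around the point, where no condition
  \<open>f (X k) \<longlonglongrightarrow> f x\<close> is needed.\<close>

definition limiting_subdifferential :: "('a::real_inner \<Rightarrow> real) \<Rightarrow> 'a \<Rightarrow> 'a set" where
  "limiting_subdifferential f x =
     {p. \<exists>X P. X \<longlonglongrightarrow> x \<and> P \<longlonglongrightarrow> p \<and> (\<forall>k. P k \<in> regular_subdifferential f (X k))}"

definition newton_direction :: "('a::real_normed_vector \<Rightarrow> 'a) \<Rightarrow> 'a \<Rightarrow> 'a \<Rightarrow> bool" where
  "newton_direction H x d \<longleftrightarrow> has_dir_deriv H x d (- H x)"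

definition newton_step :: "('a::real_normed_vector \<Rightarrow> 'a) \<Rightarrow> 'a \<Rightarrow> 'a \<Rightarrow> bool" where
  "newton_step H x x' \<longleftrightarrow> (\<exists>d. newton_direction H x d \<and> x' = x + d)"

text \<open>Since the direction need not be unique, well-definedness means that every point that can
  be reached by finitely many Newton steps admits a further Newton direction.\<close>

definition newton_well_defined :: "('a::real_normed_vector \<Rightarrow> 'a) \<Rightarrow> 'a \<Rightarrow> bool" where
  "newton_well_defined H x0 \<longleftrightarrow> (\<forall>x. (newton_step H)\<^sup>*\<^sup>* x0 x \<longrightarrow> (\<exists>d. newton_direction H x d))"

definition newton_sequence :: "('a::real_normed_vector \<Rightarrow> 'a) \<Rightarrow> 'a \<Rightarrow> (nat \<Rightarrow> 'a) \<Rightarrow> bool" where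
  "newton_sequence H x0 x \<longleftrightarrow> x 0 = x0 \<and> (\<forall>k. newton_step H (x k) (x (Suc k)))"

definition converges_superlinearly :: "(nat \<Rightarrow> 'a::real_normed_vector) \<Rightarrow> 'a \<Rightarrow> bool" where
  "converges_superlinearly x xbar \<longleftrightarrow>
     x \<longlonglongrightarrow> xbar \<and> (\<lambda>k. norm (x (Suc k) - xbar)) \<in> o(\<lambda>k. norm (x k - xbar))"

end

theory Submission
  imports Defs
begin

text \<open>
  Near \<open>xbar\<close> the map \<open>H\<close> is a Lipschitz homeomorphism with Lipschitz inverse, and Newton's method
  converges because the linearisation error of \<open>H\<close> is small in the one direction that matters.

  Write \<open>D x d\<close> for \<open>H'(x;d)\<close>. Injectivity together with either form of metric regularity gives a
  constant \<open>\<mu>\<close> with \<open>\<parallel>x - u\<parallel> \<le> \<mu> \<parallel>H x - H u\<parallel>\<close> near \<open>xbar\<close>. Dividing by \<open>t\<close> and letting \<open>t\<close> tend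
  to \<open>0\<close> transfers this expansion to \<open>D x\<close>, so a Newton direction \<open>d\<close> at \<open>x\<close>, which satisfies
  \<open>D x d = - H x\<close>, obeys
  \<open>\<parallel>x + d - xbar\<parallel> = \<parallel>d - (xbar - x)\<parallel> \<le> \<mu> \<parallel>H x + D x (xbar - x)\<parallel>\<close>.
  Superlinear convergence follows because the right-hand side is \<open>o(\<parallel>x - xbar\<parallel>)\<close>
  (lemma \<open>semismooth_newton_remainder\<close>). Newton directions exist because \<open>H\<close> is open near \<open>xbar\<close> by
  invariance of domain: the preimages of \<open>H x - t *\<^sub>R H x\<close> are \<open>x + t *\<^sub>R d\<^sub>t\<close> with bounded
  \<open>d\<^sub>t\<close>, and every cluster point of \<open>d\<^sub>t\<close> as \<open>t\<close> tends to \<open>0\<close> is a direction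
  (lemma \<open>ex_has_dir_deriv_eq\<close>).

  The remainder estimate has to pass from Clarke Jacobians, which semismoothness controls, to one-sided
  derivatives. Differentiability points suffice for this: there the Jacobian itself belongs to the
  Clarke Jacobian, so semismoothness says that \<open>D y h\<close> is close to a fixed vector \<open>l\<close> for almost all
  \<open>y\<close> in an open neighbourhood of a short ray from \<open>xbar\<close> in direction \<open>h\<close>. A mean value inequality
  that tolerates null sets (lemma \<open>norm_increment_le_of_dir_deriv_near_ae\<close>) then compares the
  increments of \<open>H\<close> along this ray with multiples of \<open>l\<close>: small increments at \<open>x\<close> give
  \<open>D x (xbar - x)\<close>, the whole increment gives \<open>H x\<close>, and the two contributions of \<open>l\<close> cancel.

  Both the almost everywhere differentiability of \<open>H\<close> (a case of Rademacher's theorem, lemma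
  \<open>negligible_not_has_derivative_dir_deriv\<close>) and this mean value inequality are obtained from the box
  averages \<open>F x = integral (cbox a b) (\<lambda>y. H (x + y))\<close>. By dominated convergence \<open>F\<close> has the
  one-sided derivatives \<open>integral (cbox a b) (\<lambda>y. D (x + y) d)\<close>, which do not see null sets and depend
  continuously on \<open>x\<close>; hence they are additive in \<open>d\<close>, and Lebesgue differentiation passes additivity
  on to \<open>D x\<close> for almost every \<open>x\<close>.

  When metric regularity is given through the limiting subdifferential, a failure of the expansion
  estimate yields, by minimising \<open>\<parallel>H w - H u\<parallel> + c \<parallel>w - x\<parallel>\<close>, unit vectors \<open>z\<close> and points \<open>v\<close> near
  \<open>xbar\<close> from which \<open>z \<bullet> H\<close> decreases at rate at most \<open>2 * c\<close>. Compactness of the sphere allows these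
  \<open>z\<close> to be replaced by a single one as \<open>c\<close> tends to \<open>0\<close>, and a second minimisation turns the rates into
  regular subgradients of \<open>z \<bullet> H\<close> tending to \<open>0\<close>. Thus \<open>0\<close> belongs to the limiting subdifferential of
  \<open>z \<bullet> H\<close> at \<open>xbar\<close> although \<open>z \<noteq> 0\<close>.
\<close>

section \<open>One-sided directional derivatives of Lipschitz maps\<close>

lemma has_dir_deriv_unique: "has_dir_deriv H x d v \<Longrightarrow> has_dir_deriv H x d w \<Longrightarrow> v = w"
  unfolding has_dir_deriv_def using tendsto_unique trivial_limit_at_right_real by blast

lemma has_dir_deriv_zero: "has_dir_deriv H x 0 0"
  unfolding has_dir_deriv_def by simp

lemma has_dir_deriv_scaleR:
  assumes "has_dir_deriv H x d v" "c \<ge> 0"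
  shows "has_dir_deriv H x (c *\<^sub>R d) (c *\<^sub>R v)"
proof (cases "c = 0")
  case True
  then show ?thesis by (simp add: has_dir_deriv_zero)
next
  case False
  then have "c > 0" using assms by simp
  have "filterlim (\<lambda>t. c * t) (at_right 0) (at_right 0)"
    using filterlim_times_pos[of "\<lambda>t::real. t" 0 "at_right 0" c 0] \<open>c > 0\<close>
    by (simp add: filterlim_ident)
  from filterlim_compose[OF assms(1)[unfolded has_dir_deriv_def] this]
  have "((\<lambda>t. c *\<^sub>R ((H (x + (c * t) *\<^sub>R d) - H x) /\<^sub>R (c * t))) \<longlongrightarrow> c *\<^sub>R v) (at_right 0)"
    by (intro tendsto_intros)
  then show ?thesis
    unfolding has_dir_deriv_def using False by (simp add: mult.commute field_simps)
qed

lemma eventually_in_open_at_right: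
  assumes "open S" "(x::'a::real_normed_vector) \<in> S"
  shows "\<forall>\<^sub>F t in at_right 0. x + t *\<^sub>R d \<in> S"
proof -
  have "((\<lambda>t. x + t *\<^sub>R d) \<longlongrightarrow> x + 0 *\<^sub>R d) (at_right 0)"
    by (intro tendsto_intros)
  then show ?thesis
    using assms topological_tendstoD by fastforce
qed

lemma has_dir_deriv_diff_le:
  assumes "open S" "x \<in> S" "L-lipschitz_on S H"
    and "has_dir_deriv H x d v" "has_dir_deriv H x e w"
  shows "norm (v - w) \<le> L * norm (d - e)"
proof (rule tendsto_upperbound)
  show "((\<lambda>t. norm ((H (x + t *\<^sub>R d) - H x) /\<^sub>R t - (H (x + t *\<^sub>R e) - H x) /\<^sub>R t)) \<longlongrightarrow> norm (v - w)) (at_right 0)"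
    using assms(4,5) unfolding has_dir_deriv_def by (intro tendsto_intros)
  show "\<forall>\<^sub>F t in at_right 0. norm ((H (x + t *\<^sub>R d) - H x) /\<^sub>R t - (H (x + t *\<^sub>R e) - H x) /\<^sub>R t)
          \<le> L * norm (d - e)"
    using eventually_in_open_at_right[OF assms(1,2), of d] eventually_in_open_at_right[OF assms(1,2), of e]
      eventually_at_right_less[of 0]
  proof eventually_elim
    case (elim t)
    have "(H (x + t *\<^sub>R d) - H x) /\<^sub>R t - (H (x + t *\<^sub>R e) - H x) /\<^sub>R t
        = (H (x + t *\<^sub>R d) - H (x + t *\<^sub>R e)) /\<^sub>R t"
      by (simp add: algebra_simps)
    also have "norm \<dots> = norm (H (x + t *\<^sub>R d) - H (x + t *\<^sub>R e)) / t"
      using elim by (simp add: divide_inverse mult.commute)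
    also have "\<dots> \<le> (L * (t * norm (d - e))) / t"
      using lipschitz_onD[OF assms(3) elim(1,2)] elim(3)
      by (intro divide_right_mono) (auto simp: dist_norm simp flip: scaleR_diff_right)
    finally show ?case using elim by simp
  qed
qed simp

text \<open>For a Lipschitz map the one-sided derivative is a Hadamard derivative: the directions of the
  difference quotients may converge together with the step lengths. This is what makes compactness
  arguments in the direction possible.\<close>

lemma has_dir_deriv_sequentially_variable_direction:
  assumes S: "open S" "x \<in> S" "L-lipschitz_on S H" and v: "has_dir_deriv H x d v"
    and t: "t \<longlonglongrightarrow> 0" "\<And>k. t k > (0::real)" and e: "e \<longlonglongrightarrow> d"
  shows "(\<lambda>k. (H (x + t k *\<^sub>R e k) - H x) /\<^sub>R t k) \<longlonglongrightarrow> v"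
proof -
  have t0: "filterlim t (at_right 0) sequentially"
    using t by (auto simp: filterlim_at less_imp_neq[symmetric] intro!: always_eventually)
  have 1: "(\<lambda>k. (H (x + t k *\<^sub>R d) - H x) /\<^sub>R t k) \<longlonglongrightarrow> v"
    using filterlim_compose[OF v[unfolded has_dir_deriv_def] t0] .
  have "(\<lambda>k. x + t k *\<^sub>R e k) \<longlonglongrightarrow> x + 0 *\<^sub>R d" "(\<lambda>k. x + t k *\<^sub>R d) \<longlonglongrightarrow> x + 0 *\<^sub>R d"
    by (intro tendsto_intros t e)+
  then have ev: "\<forall>\<^sub>F k in sequentially. x + t k *\<^sub>R e k \<in> S" "\<forall>\<^sub>F k in sequentially. x + t k *\<^sub>R d \<in> S"
    using S topological_tendstoD by fastforce+
  have "(\<lambda>k. (H (x + t k *\<^sub>R e k) - H x) /\<^sub>R t k - (H (x + t k *\<^sub>R d) - H x) /\<^sub>R t k) \<longlonglongrightarrow> 0"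
  proof (rule Lim_null_comparison)
    show "\<forall>\<^sub>F k in sequentially. norm ((H (x + t k *\<^sub>R e k) - H x) /\<^sub>R t k - (H (x + t k *\<^sub>R d) - H x) /\<^sub>R t k)
       \<le> L * norm (e k - d)"
      using ev
    proof eventually_elim
      case (elim k)
      have "(H (x + t k *\<^sub>R e k) - H x) /\<^sub>R t k - (H (x + t k *\<^sub>R d) - H x) /\<^sub>R t k
          = (H (x + t k *\<^sub>R e k) - H (x + t k *\<^sub>R d)) /\<^sub>R t k"
        by (simp add: algebra_simps)
      also have "norm \<dots> = norm (H (x + t k *\<^sub>R e k) - H (x + t k *\<^sub>R d)) / t k"
        using t(2)[of k] by (simp add: divide_inverse mult.commute)
      also have "\<dots> \<le> (L * (t k * norm (e k - d))) / t k"
        using lipschitz_onD[OF S(3) elim(1,2)] t(2)[of k]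
        by (intro divide_right_mono) (auto simp: dist_norm simp flip: scaleR_diff_right)
      finally show ?case using t(2)[of k] by simp
    qed
    have "(\<lambda>k. L * norm (e k - d)) \<longlonglongrightarrow> L * norm (d - d)"
      by (intro tendsto_intros e)
    then show "(\<lambda>k. L * norm (e k - d)) \<longlonglongrightarrow> 0" by simp
  qed
  from tendsto_add[OF this 1] show ?thesis by simp
qed

section \<open>A mean value inequality for one-sided derivatives\<close>

text \<open>Right derivatives are enough for the mean value inequality. With a slack \<open>\<eta>\<close> in the slope, the set of
  points at which the estimate holds is closed, and a right derivative of norm at most \<open>e\<close> lets one
  continue strictly beyond any of its points other than \<open>b\<close>; so its supremum is \<open>b\<close>.\<close>

lemma norm_diff_le_of_right_deriv_le:
  fixes f :: "real \<Rightarrow> 'b::real_normed_vector"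
  assumes "a \<le> b" and cont: "continuous_on {a..b} f"
    and deriv: "\<And>s. a \<le> s \<Longrightarrow> s < b \<Longrightarrow> \<exists>v. has_dir_deriv f s 1 v \<and> norm v \<le> e"
  shows "norm (f b - f a) \<le> e * (b - a)"
proof (rule field_le_epsilon)
  fix \<epsilon> :: real assume "\<epsilon> > 0"
  define \<eta> where "\<eta> = \<epsilon> / (b - a + 1)"
  have "\<eta> > 0" using \<open>\<epsilon> > 0\<close> \<open>a \<le> b\<close> by (simp add: \<eta>_def)
  define A where "A = {s\<in>{a..b}. norm (f s - f a) \<le> (e + \<eta>) * (s - a)}"
  have "closed A"
    unfolding A_def by (intro continuous_on_closed_Collect_le continuous_intros cont closed_atLeastAtMost)
  moreover have "a \<in> A" "bdd_above A" using \<open>a \<le> b\<close> by (auto simp: A_def)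
  ultimately have Sup: "Sup A \<in> A"
    using closed_contains_Sup by blast
  have "Sup A = b"
  proof (rule ccontr)
    assume "Sup A \<noteq> b"
    define s where "s = Sup A"
    have s: "a \<le> s" "s < b" "norm (f s - f a) \<le> (e + \<eta>) * (s - a)"
      using Sup \<open>Sup A \<noteq> b\<close> by (auto simp: A_def s_def)
    obtain v where v: "has_dir_deriv f s 1 v" "norm v \<le> e"
      using deriv s by blast
    have "\<forall>\<^sub>F t in at_right 0. dist ((f (s + t *\<^sub>R 1) - f s) /\<^sub>R t) v < \<eta>"
      using v(1) \<open>\<eta> > 0\<close> unfolding has_dir_deriv_def by (simp add: tendstoD)
    moreover have "\<forall>\<^sub>F t in at_right 0. t < b - s"
      using eventually_at_right_real[of 0 "b - s"] s by (auto elim: eventually_mono)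
    ultimately have "\<forall>\<^sub>F t in at_right 0. s + t \<in> A"
      using eventually_at_right_less[of 0]
    proof eventually_elim
      case (elim t)
      have "norm ((f (s + t) - f s) /\<^sub>R t) \<le> norm v + \<eta>"
        using elim(1) norm_triangle_ineq2[of "(f (s + t) - f s) /\<^sub>R t" v]
        by (simp add: dist_norm)
      then have "norm (f (s + t) - f s) / t \<le> e + \<eta>"
        using v(2) elim(3) by (simp add: divide_inverse mult.commute)
      then have "norm (f (s + t) - f s) \<le> (e + \<eta>) * t"
        using elim(3) by (simp add: divide_le_eq)
      then have "norm (f (s + t) - f a) \<le> (e + \<eta>) * t + (e + \<eta>) * (s - a)"
        using s(3) norm_triangle_ineq[of "f (s + t) - f s" "f s - f a"] by simp
      then show ?case
        using s elim by (simp add: A_def algebra_simps)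
    qed
    then have "\<forall>\<^sub>F t in at_right 0. s + t \<in> A \<and> t > 0"
      using eventually_at_right_less[of 0] by eventually_elim simp
    then obtain t where "t > 0" "s + t \<in> A"
      using eventually_happens'[of "at_right (0::real)"] trivial_limit_at_right_real by blast
    then show False
      using cSup_upper[OF _ \<open>bdd_above A\<close>] unfolding s_def by fastforce
  qed
  with Sup have "norm (f b - f a) \<le> (e + \<eta>) * (b - a)"
    by (simp add: A_def)
  also have "\<dots> = e * (b - a) + \<epsilon> * ((b - a) / (b - a + 1))"
    using \<open>a \<le> b\<close> by (simp add: \<eta>_def algebra_simps)
  also have "\<dots> \<le> e * (b - a) + \<epsilon>"
    using \<open>a \<le> b\<close> \<open>\<epsilon> > 0\<close> by (intro add_left_mono mult_left_le) auto
  finally show "norm (f b - f a) \<le> e * (b - a) + \<epsilon>" .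
qed

text \<open>The mean value inequality along a segment, applied to \<open>F\<close> minus the affine function with increment
  \<open>c\<close>.\<close>

lemma norm_increment_le_of_dir_deriv_near:
  fixes F :: "'a::real_normed_vector \<Rightarrow> 'b::real_normed_vector"
  assumes cont: "continuous_on ((\<lambda>s. x + s *\<^sub>R d) ` {0..1}) F"
    and deriv: "\<And>s. 0 \<le> s \<Longrightarrow> s < 1 \<Longrightarrow>
                  \<exists>v. has_dir_deriv F (x + s *\<^sub>R d) d v \<and> norm (v - c) \<le> e"
  shows "norm (F (x + d) - F x - c) \<le> e"
proof -
  define f where "f s = F (x + s *\<^sub>R d) - s *\<^sub>R c" for s
  have "norm (f 1 - f 0) \<le> e * (1 - 0)"
  proof (rule norm_diff_le_of_right_deriv_le)
    show "continuous_on {0..1} f"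
      unfolding f_def by (intro continuous_intros continuous_on_compose2[OF cont]) auto
    fix s :: real assume "0 \<le> s" "s < 1"
    then obtain v where v: "has_dir_deriv F (x + s *\<^sub>R d) d v" "norm (v - c) \<le> e"
      using deriv by blast
    have "has_dir_deriv f s 1 (v - c)"
      unfolding has_dir_deriv_def
    proof (rule Lim_transform_eventually)
      show "((\<lambda>t. (F (x + s *\<^sub>R d + t *\<^sub>R d) - F (x + s *\<^sub>R d)) /\<^sub>R t - c) \<longlongrightarrow> v - c) (at_right 0)"
        using v(1) unfolding has_dir_deriv_def by (intro tendsto_intros)
      show "\<forall>\<^sub>F t in at_right 0. (F (x + s *\<^sub>R d + t *\<^sub>R d) - F (x + s *\<^sub>R d)) /\<^sub>R t - c
              = (f (s + t *\<^sub>R 1) - f s) /\<^sub>R t"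
        using eventually_at_right_less[of 0]
        by eventually_elim (simp add: f_def scaleR_add_left add.assoc scaleR_diff_right divide_simps)
    qed
    then show "\<exists>v. has_dir_deriv f s 1 v \<and> norm v \<le> e" using v by blast
  qed auto
  then show ?thesis by (simp add: f_def algebra_simps)
qed

section \<open>Box averages\<close>

text \<open>Box averages commute with one-sided differentiation by dominated convergence: the Lipschitz constant
  bounds all difference quotients. Integrability of the derivative, which is only a pointwise limit of
  continuous functions, is part of the result.\<close>

lemma mollified_has_dir_deriv:
  fixes H :: "'a::euclidean_space \<Rightarrow> 'b::euclidean_space"
  assumes S: "open S" "L-lipschitz_on S H" and sub: "\<And>y. y \<in> cbox a b \<Longrightarrow> x + y \<in> S"
    and deriv: "\<And>z. z \<in> S \<Longrightarrow> has_dir_deriv H z d (D z)"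
  shows "(\<lambda>y. D (x + y)) integrable_on cbox a b"
    and "has_dir_deriv (\<lambda>x. integral (cbox a b) (\<lambda>y. H (x + y))) x d (integral (cbox a b) (\<lambda>y. D (x + y)))"
proof -
  let ?K = "(+) x ` cbox a b"
  have "compact ?K" by (simp add: compact_translation)
  moreover have "?K \<subseteq> S" using sub by auto
  ultimately obtain \<epsilon> where "\<epsilon> > 0" and \<epsilon>: "(\<Union>z\<in>?K. ball z \<epsilon>) \<subseteq> S"
    using compact_subset_open_imp_ball_epsilon_subset S(1) by metis
  define t0 where "t0 = \<epsilon> / (norm d + 1)"
  have "norm d + 1 > 0" by (simp add: add_nonneg_pos)
  then have "t0 > 0" using \<open>\<epsilon> > 0\<close> by (simp add: t0_def)
  have inS: "x + y + t *\<^sub>R d \<in> S" if "y \<in> cbox a b" "0 \<le> t" "t < t0" for y t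
  proof -
    have "t * norm d \<le> t * (norm d + 1)" using that by (simp add: mult_left_mono)
    also have "\<dots> < \<epsilon>" using that \<open>norm d + 1 > 0\<close> by (simp add: t0_def less_divide_eq)
    finally have "x + y + t *\<^sub>R d \<in> ball (x + y) \<epsilon>" using that by (simp add: dist_norm)
    then show ?thesis using \<epsilon> that by blast
  qed
  have H_int: "(\<lambda>y. H (x + y + t *\<^sub>R d)) integrable_on cbox a b" if "0 \<le> t" "t < t0" for t
    by (intro integrable_continuous continuous_on_compose2[OF lipschitz_on_continuous_on[OF S(2)]]
        continuous_intros) (use inS that in auto)
  have lim: "(\<lambda>y. D (x + y)) integrable_on cbox a b \<and>
     (\<lambda>k. integral (cbox a b) (\<lambda>y. (H (x + y + t k *\<^sub>R d) - H (x + y)) /\<^sub>R t k))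
       \<longlonglongrightarrow> integral (cbox a b) (\<lambda>y. D (x + y))"
    if t: "\<And>k. 0 < t k" "\<And>k. t k < t0" "t \<longlonglongrightarrow> 0" for t :: "nat \<Rightarrow> real"
  proof -
    let ?q = "\<lambda>k y. (H (x + y + t k *\<^sub>R d) - H (x + y)) /\<^sub>R t k"
    have q: "?q k integrable_on cbox a b" for k
      using H_int[of "t k"] H_int[of 0] t(1)[of k] t(2)[of k] \<open>t0 > 0\<close>
      by (intro integrable_cmul integrable_diff) auto
    have bound: "norm (?q k y) \<le> L * norm d" if y: "y \<in> cbox a b" for k y
    proof -
      have "norm (H (x + y + t k *\<^sub>R d) - H (x + y)) / t k \<le> (L * (t k * norm d)) / t k"
        using lipschitz_onD[OF S(2) inS[OF y, of "t k"] sub[OF y]] t(1)[of k] t(2)[of k]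
        by (intro divide_right_mono) (auto simp: dist_norm)
      moreover have "norm (?q k y) = norm (H (x + y + t k *\<^sub>R d) - H (x + y)) / t k"
        using t(1)[of k] by (simp add: divide_inverse mult.commute)
      ultimately show ?thesis
        using t(1)[of k] by simp
    qed
    have "filterlim t (at_right 0) sequentially"
      using t by (auto simp: filterlim_at less_imp_neq[symmetric] intro!: always_eventually)
    then have conv: "(\<lambda>k. ?q k y) \<longlonglongrightarrow> D (x + y)" if "y \<in> cbox a b" for y
      using filterlim_compose[OF deriv[OF sub[OF that], unfolded has_dir_deriv_def]] by blast
    have "(\<lambda>y. L * norm d) integrable_on cbox a b" by (rule integrable_const)
    from dominated_convergence[OF q this bound conv] show ?thesis by blast
  qed
  have "(\<lambda>k. t0 / real (Suc (Suc k))) \<longlonglongrightarrow> 0"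
    using LIMSEQ_Suc[OF LIMSEQ_Suc[OF lim_const_over_n[of t0]]] by simp
  moreover have "t0 / real (Suc (Suc k)) < t0" for k
    using \<open>t0 > 0\<close> by (simp add: divide_less_eq)
  ultimately show "(\<lambda>y. D (x + y)) integrable_on cbox a b"
    using lim[of "\<lambda>k. t0 / real (Suc (Suc k))"] \<open>t0 > 0\<close> by simp
  show "has_dir_deriv (\<lambda>x. integral (cbox a b) (\<lambda>y. H (x + y))) x d (integral (cbox a b) (\<lambda>y. D (x + y)))"
    unfolding has_dir_deriv_def
  proof (rule tendsto_at_right_sequentially[OF \<open>t0 > 0\<close>])
    fix t :: "nat \<Rightarrow> real" assume t: "\<And>k. 0 < t k" "\<And>k. t k < t0" "t \<longlonglongrightarrow> 0"
    have eq: "x + y + t k *\<^sub>R d = x + t k *\<^sub>R d + y" for k y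
      by (simp add: algebra_simps)
    have "integral (cbox a b) (\<lambda>y. (H (x + y + t k *\<^sub>R d) - H (x + y)) /\<^sub>R t k)
       = (integral (cbox a b) (\<lambda>y. H (x + t k *\<^sub>R d + y)) - integral (cbox a b) (\<lambda>y. H (x + y))) /\<^sub>R t k" for k
      using H_int[of "t k"] H_int[of 0] t(1)[of k] t(2)[of k] \<open>t0 > 0\<close>
      by (simp add: integral_diff eq)
    with lim[OF t] show "(\<lambda>k. (integral (cbox a b) (\<lambda>y. H (x + t k *\<^sub>R d + y))
         - integral (cbox a b) (\<lambda>y. H (x + y))) /\<^sub>R t k) \<longlonglongrightarrow> integral (cbox a b) (\<lambda>y. D (x + y))"
      by (simp only:)
  qed
qed

lemma mollified_lipschitz:
  fixes H :: "'a::euclidean_space \<Rightarrow> 'b::euclidean_space"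
  assumes S: "L-lipschitz_on S H" and sub: "\<And>x y. x \<in> T \<Longrightarrow> y \<in> cbox a b \<Longrightarrow> x + y \<in> S"
  shows "(L * measure lborel (cbox a b))-lipschitz_on T (\<lambda>x. integral (cbox a b) (\<lambda>y. H (x + y)))"
proof (rule lipschitz_onI)
  have L: "0 \<le> L" using S by (rule lipschitz_on_nonneg)
  then show "0 \<le> L * measure lborel (cbox a b)" by simp
  have int: "(\<lambda>y. H (x + y)) integrable_on cbox a b" if "x \<in> T" for x
    by (intro integrable_continuous continuous_on_compose2[OF lipschitz_on_continuous_on[OF S]]
        continuous_intros) (use sub that in auto)
  fix x x' assume T: "x \<in> T" "x' \<in> T"
  have "norm (integral (cbox a b) (\<lambda>y. H (x + y) - H (x' + y))) \<le> L * dist x x' * measure lborel (cbox a b)"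
  proof (rule integrable_bound)
    show "norm (H (x + y) - H (x' + y)) \<le> L * dist x x'" if "y \<in> cbox a b" for y
      using lipschitz_onD[OF S sub[OF T(1) that] sub[OF T(2) that]] by (simp add: dist_norm)
  qed (use L T in \<open>auto intro!: integrable_diff int\<close>)
  then show "dist (integral (cbox a b) (\<lambda>y. H (x + y))) (integral (cbox a b) (\<lambda>y. H (x' + y)))
      \<le> L * measure lborel (cbox a b) * dist x x'"
    using T by (simp add: dist_norm integral_diff int mult_ac)
qed

section \<open>Almost everywhere differentiability\<close>

text \<open>A function with one-sided directional derivatives that are continuous in the base point is additive in
  the direction: one goes from \<open>0\<close> to \<open>t *\<^sub>R (d1 + d2)\<close> by way of \<open>t *\<^sub>R d1\<close>, and on the second leg
  the mean value inequality allows the derivative at \<open>0\<close> to be used. Although \<open>H\<close> need not have this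
  continuity, its box average \<open>F\<close> does, because an indefinite integral depends continuously on the
  box. The larger box \<open>cbox a' b'\<close> leaves room for moving the smaller one.\<close>

lemma integral_dir_deriv_additive:
  fixes H :: "'a::euclidean_space \<Rightarrow> 'b::euclidean_space"
  assumes S: "open S" "L-lipschitz_on S H"
    and deriv: "\<And>z d. z \<in> S \<Longrightarrow> has_dir_deriv H z d (D z d)"
    and sub: "cbox a' b' \<subseteq> S" "cbox a b \<subseteq> box a' b'"
  shows "integral (cbox a b) (\<lambda>y. D y (d1 + d2))
       = integral (cbox a b) (\<lambda>y. D y d1) + integral (cbox a b) (\<lambda>y. D y d2)"
proof (cases "cbox a b = {}")
  case False
  then have ab: "a \<in> cbox a b" "b \<in> cbox a b"
    by (auto simp: mem_box box_ne_empty)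
  then obtain \<epsilon>1 \<epsilon>2 where \<epsilon>12: "\<epsilon>1 > 0" "\<epsilon>2 > 0" "ball a \<epsilon>1 \<subseteq> box a' b'" "ball b \<epsilon>2 \<subseteq> box a' b'"
    using sub(2) open_box[of a' b'] by (meson openE subsetD)
  define \<epsilon> where "\<epsilon> = min \<epsilon>1 \<epsilon>2"
  have "\<epsilon> > 0" using \<epsilon>12 by (simp add: \<epsilon>_def)
  have shift: "a + x \<in> cbox a' b'" "b + x \<in> cbox a' b'" if "norm x < \<epsilon>" for x
  proof -
    have "a + x \<in> ball a \<epsilon>1" "b + x \<in> ball b \<epsilon>2" using that by (auto simp: \<epsilon>_def dist_norm)
    then show "a + x \<in> cbox a' b'" "b + x \<in> cbox a' b'" using \<epsilon>12 box_subset_cbox by blast+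
  qed
  have inS: "x + y \<in> S" if "norm x < \<epsilon>" "y \<in> cbox a b" for x y
  proof -
    have "x + y \<in> cbox (a + x) (b + x)" using that(2) by (auto simp: mem_box inner_add_left)
    also have "\<dots> \<subseteq> cbox a' b'" using shift[OF that(1)] by (simp add: mem_box subset_box)
    finally show ?thesis using sub(1) by blast
  qed
  define F where "F x = integral (cbox a b) (\<lambda>y. H (x + y))" for x
  define G where "G x d = integral (cbox a b) (\<lambda>y. D (x + y) d)" for x d
  have F: "has_dir_deriv F x d (G x d)" if "norm x < \<epsilon>" for x d
    unfolding F_def[abs_def] G_def
    by (rule mollified_has_dir_deriv(2)[OF S]) (use inS that deriv in auto)
  have Fcont: "continuous_on (ball 0 \<epsilon>) F"
    unfolding F_def[abs_def]
    by (rule lipschitz_on_continuous_on, rule mollified_lipschitz[OF S(2)]) (use inS in auto)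
  have Gcont: "\<exists>\<delta>>0. \<forall>x. norm x \<le> \<delta> \<longrightarrow> norm (G x d2 - G 0 d2) < \<eta>" if "\<eta> > 0" for \<eta>
  proof -
    have "(\<lambda>y. D (0 + y) d2) integrable_on cbox a' b'"
      by (rule mollified_has_dir_deriv(1)[OF S]) (use sub deriv in auto)
    then have int: "(\<lambda>y. D y d2) integrable_on cbox a' b'" by simp
    obtain \<delta> where "\<delta> > 0" and \<delta>: "\<And>c' d'. \<lbrakk>c' \<in> cbox a' b'; d' \<in> cbox a' b'; norm (c' - a) \<le> \<delta>; norm (d' - b) \<le> \<delta>\<rbrakk>
        \<Longrightarrow> norm (integral (cbox c' d') (\<lambda>y. D y d2) - integral (cbox a b) (\<lambda>y. D y d2)) < \<eta>"
      using indefinite_integral_continuous[OF int, of a b \<eta>] shift[of 0] \<open>\<epsilon> > 0\<close> \<open>\<eta> > 0\<close> by auto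
    have G_eq: "G x d2 = integral (cbox (a + x) (b + x)) (\<lambda>y. D y d2)" for x
      unfolding G_def using integral_shift_cbox_plus[of a b "\<lambda>y. D y d2" x] by (simp add: o_def)
    have "norm (G x d2 - G 0 d2) < \<eta>" if "norm x \<le> min \<delta> (\<epsilon> / 2)" for x
      using \<delta>[of "a + x" "b + x"] shift[of x] that \<open>\<epsilon> > 0\<close> unfolding G_eq by simp
    then show ?thesis using \<open>\<delta> > 0\<close> \<open>\<epsilon> > 0\<close> by (intro exI[of _ "min \<delta> (\<epsilon> / 2)"]) auto
  qed
  have "((\<lambda>t. (F (t *\<^sub>R d1 + t *\<^sub>R d2) - F (t *\<^sub>R d1)) /\<^sub>R t) \<longlongrightarrow> G 0 d2) (at_right 0)"
  proof (rule tendstoI)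
    fix \<eta> :: real assume "\<eta> > 0"
    then obtain \<delta> where "\<delta> > 0" and \<delta>: "\<And>x. norm x \<le> \<delta> \<Longrightarrow> norm (G x d2 - G 0 d2) < \<eta> / 2"
      using Gcont[of "\<eta> / 2"] by auto
    have "((\<lambda>t. t * (norm d1 + norm d2)) \<longlongrightarrow> 0 * (norm d1 + norm d2)) (at_right 0)"
      by (intro tendsto_intros)
    then have "\<forall>\<^sub>F t in at_right 0. t * (norm d1 + norm d2) < min \<delta> \<epsilon>"
      using \<open>\<delta> > 0\<close> \<open>\<epsilon> > 0\<close> by (intro order_tendstoD) auto
    then show "\<forall>\<^sub>F t in at_right 0. dist ((F (t *\<^sub>R d1 + t *\<^sub>R d2) - F (t *\<^sub>R d1)) /\<^sub>R t) (G 0 d2) < \<eta>"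
      using eventually_at_right_less[of 0]
    proof eventually_elim
      case (elim t)
      have small: "norm (t *\<^sub>R d1 + s *\<^sub>R t *\<^sub>R d2) < min \<delta> \<epsilon>" if "0 \<le> s" "s \<le> 1" for s
      proof -
        have "norm (t *\<^sub>R d1 + s *\<^sub>R t *\<^sub>R d2) \<le> t * norm d1 + s * (t * norm d2)"
          using norm_triangle_ineq[of "t *\<^sub>R d1" "s *\<^sub>R t *\<^sub>R d2"] that elim by simp
        also have "\<dots> \<le> t * norm d1 + t * norm d2"
          using that elim by (intro add_left_mono mult_left_le_one_le) auto
        finally show ?thesis using elim by (simp add: algebra_simps)
      qed
      have "norm (F (t *\<^sub>R d1 + t *\<^sub>R d2) - F (t *\<^sub>R d1) - t *\<^sub>R G 0 d2) \<le> t * (\<eta> / 2)"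
      proof (rule norm_increment_le_of_dir_deriv_near)
        show "continuous_on ((\<lambda>s. t *\<^sub>R d1 + s *\<^sub>R t *\<^sub>R d2) ` {0..1}) F"
          by (rule continuous_on_subset[OF Fcont]) (use small in auto)
        fix s :: real assume s: "0 \<le> s" "s < 1"
        let ?x = "t *\<^sub>R d1 + s *\<^sub>R t *\<^sub>R d2"
        have "has_dir_deriv F ?x (t *\<^sub>R d2) (t *\<^sub>R G ?x d2)"
          using F[of ?x d2] small[of s] s elim by (intro has_dir_deriv_scaleR) auto
        moreover have "norm (t *\<^sub>R G ?x d2 - t *\<^sub>R G 0 d2) \<le> t * (\<eta> / 2)"
          using \<delta>[of ?x] small[of s] s elim
          by (simp flip: scaleR_diff_right)
        ultimately show "\<exists>v. has_dir_deriv F ?x (t *\<^sub>R d2) v \<and> norm (v - t *\<^sub>R G 0 d2) \<le> t * (\<eta> / 2)"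
          by blast
      qed
      moreover have "(F (t *\<^sub>R d1 + t *\<^sub>R d2) - F (t *\<^sub>R d1)) /\<^sub>R t - G 0 d2
           = (F (t *\<^sub>R d1 + t *\<^sub>R d2) - F (t *\<^sub>R d1) - t *\<^sub>R G 0 d2) /\<^sub>R t"
        using elim by (simp add: scaleR_diff_right)
      ultimately have "norm ((F (t *\<^sub>R d1 + t *\<^sub>R d2) - F (t *\<^sub>R d1)) /\<^sub>R t - G 0 d2) \<le> inverse t * (t * (\<eta> / 2))"
        using elim by (simp only: norm_scaleR abs_inverse abs_of_pos) (intro mult_left_mono; simp)
      then have "norm ((F (t *\<^sub>R d1 + t *\<^sub>R d2) - F (t *\<^sub>R d1)) /\<^sub>R t - G 0 d2) \<le> \<eta> / 2"
        using elim by (simp flip: mult.assoc)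
      then show ?case using \<open>\<eta> > 0\<close> by (simp add: dist_norm)
    qed
  qed
  from tendsto_add[OF this F[of 0 d1, unfolded has_dir_deriv_def]] \<open>\<epsilon> > 0\<close>
  have "((\<lambda>t. (F (t *\<^sub>R d1 + t *\<^sub>R d2) - F 0) /\<^sub>R t) \<longlongrightarrow> G 0 d2 + G 0 d1) (at_right 0)"
    by (simp flip: scaleR_add_right)
  then have "has_dir_deriv F 0 (d1 + d2) (G 0 d2 + G 0 d1)"
    by (simp add: has_dir_deriv_def scaleR_add_right)
  with F[of 0 "d1 + d2"] \<open>\<epsilon> > 0\<close> show ?thesis
    using has_dir_deriv_unique unfolding G_def by fastforce
qed simp

text \<open>Lebesgue differentiation recovers \<open>D x d\<close> from averages over shrinking boxes for all \<open>x\<close> outside a null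
  set depending on \<open>d\<close>, so the additivity of the averages is inherited. Countably many directions,
  dense in the space, are treated at once, and Lipschitz continuity of \<open>D x\<close> reaches the others.\<close>

lemma has_dir_deriv_additive_ae:
  fixes H :: "'a::euclidean_space \<Rightarrow> 'b::euclidean_space"
  assumes S: "open S" "L-lipschitz_on S H"
    and deriv: "\<And>z d. z \<in> S \<Longrightarrow> has_dir_deriv H z d (D z d)"
    and sub: "cbox a b \<subseteq> S"
  obtains N where "negligible N"
    "\<And>x d1 d2. x \<in> box a b - N \<Longrightarrow> D x (d1 + d2) = D x d1 + D x d2"
proof -
  define f where "f d z = (if z \<in> cbox a b then D z d else 0)" for d z
  have f_int: "f d integrable_on cbox u v" for d u v
  proof -
    have "(\<lambda>y. D (0 + y) d) integrable_on cbox a b"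
      by (rule mollified_has_dir_deriv(1)[OF S]) (use sub deriv in auto)
    then have "f d integrable_on UNIV"
      unfolding f_def[abs_def] by (simp add: integrable_restrict_UNIV)
    then show ?thesis by (rule integrable_on_subcbox) simp
  qed
  have "\<exists>N. negligible N \<and> (\<forall>x e. x \<notin> N \<longrightarrow> 0 < e \<longrightarrow> (\<exists>\<delta>>0. \<forall>h. 0 < h \<and> h < \<delta> \<longrightarrow>
       norm (integral (cbox x (x + h *\<^sub>R One)) (f d) /\<^sub>R h ^ DIM('a) - f d x) < e))" for d
    using integrable_ccontinuous_explicit[of "f d", OF f_int] by metis
  then obtain NN where NN: "\<And>d. negligible (NN d)"
    "\<And>d x e. x \<notin> NN d \<Longrightarrow> 0 < e \<Longrightarrow> (\<exists>\<delta>>0. \<forall>h. 0 < h \<and> h < \<delta> \<longrightarrow>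
       norm (integral (cbox x (x + h *\<^sub>R One)) (f d) /\<^sub>R h ^ DIM('a) - f d x) < e)"
    by metis
  obtain C :: "'a set" where C: "countable C" "\<And>X. open X \<Longrightarrow> X \<noteq> {} \<Longrightarrow> \<exists>d\<in>C. d \<in> X"
    by (rule countable_dense_setE) blast
  \<comment> \<open>Additivity on \<open>C\<close> involves the exceptional sets of the sums as well.\<close>
  define C2 where "C2 = C \<union> (\<lambda>(c, d). c + d) ` (C \<times> C)"
  have "countable C2" using C(1) by (simp add: C2_def)
  define N where "N = (\<Union>d\<in>C2. NN d)"
  show ?thesis
  proof
    show "negligible N"
      unfolding N_def using \<open>countable C2\<close> NN(1) by (intro negligible_countable_Union) auto
    fix x d1 d2 assume x: "x \<in> box a b - N"
    then have "x \<in> S" using sub box_subset_cbox by blast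
    have dense: "D x (c1 + c2) = D x c1 + D x c2" if c: "c1 \<in> C" "c2 \<in> C" for c1 c2
    proof -
      have "norm (D x (c1 + c2) - (D x c1 + D x c2)) \<le> 0 + e" if "e > 0" for e
      proof -
        have "\<exists>\<delta>>0. \<forall>h. 0 < h \<and> h < \<delta> \<longrightarrow>
            norm (integral (cbox x (x + h *\<^sub>R One)) (f d) /\<^sub>R h ^ DIM('a) - f d x) < e / 3" if "d \<in> C2" for d
          using NN(2)[of x d "e / 3"] x that \<open>e > 0\<close> by (auto simp: N_def)
        moreover have "c1 \<in> C2" "c2 \<in> C2" "c1 + c2 \<in> C2" using c by (auto simp: C2_def)
        ultimately obtain \<delta>1 \<delta>2 \<delta>3 where \<delta>: "\<delta>1 > 0" "\<delta>2 > 0" "\<delta>3 > 0"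
          "\<And>h. 0 < h \<Longrightarrow> h < \<delta>1 \<Longrightarrow> norm (integral (cbox x (x + h *\<^sub>R One)) (f c1) /\<^sub>R h ^ DIM('a) - f c1 x) < e / 3"
          "\<And>h. 0 < h \<Longrightarrow> h < \<delta>2 \<Longrightarrow> norm (integral (cbox x (x + h *\<^sub>R One)) (f c2) /\<^sub>R h ^ DIM('a) - f c2 x) < e / 3"
          "\<And>h. 0 < h \<Longrightarrow> h < \<delta>3 \<Longrightarrow> norm (integral (cbox x (x + h *\<^sub>R One)) (f (c1 + c2)) /\<^sub>R h ^ DIM('a) - f (c1 + c2) x) < e / 3"
          by metis
        have "((\<lambda>h. x + h *\<^sub>R One) \<longlongrightarrow> x + 0 *\<^sub>R One) (at_right 0)"
          by (intro tendsto_intros)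
        then have "\<forall>\<^sub>F h in at_right 0. x + h *\<^sub>R One \<in> box a b"
          using x by (intro topological_tendstoD) auto
        moreover have "\<forall>\<^sub>F h in at_right 0. h \<in> {0<..<min \<delta>1 (min \<delta>2 \<delta>3)}"
          using \<delta> by (intro eventually_at_right_real) auto
        ultimately have "\<forall>\<^sub>F h in at_right 0. x + h *\<^sub>R One \<in> box a b \<and> h \<in> {0<..<min \<delta>1 (min \<delta>2 \<delta>3)}"
          by eventually_elim simp
        then obtain h where h: "x + h *\<^sub>R One \<in> box a b" "0 < h" "h < \<delta>1" "h < \<delta>2" "h < \<delta>3"
          using eventually_happens'[of "at_right (0::real)"] trivial_limit_at_right_real by fastforce
        let ?Q = "cbox x (x + h *\<^sub>R One)"
        have Q: "?Q \<subseteq> box a b"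
          using x h(1) by (auto simp: mem_box subset_box)
        have f_eq: "integral ?Q (f d) = integral ?Q (\<lambda>y. D y d)" for d
          by (rule integral_cong) (use Q box_subset_cbox in \<open>auto simp: f_def\<close>)
        have "integral ?Q (f (c1 + c2)) = integral ?Q (f c1) + integral ?Q (f c2)"
          unfolding f_eq by (rule integral_dir_deriv_additive[OF S deriv sub Q])
        moreover have "f d x = D x d" for d using x box_subset_cbox by (auto simp: f_def)
        moreover define p q where "p = integral ?Q (f c1) /\<^sub>R h ^ DIM('a)" "q = integral ?Q (f c2) /\<^sub>R h ^ DIM('a)"
        ultimately have "norm (p + q - D x (c1 + c2)) < e / 3" "norm (p - D x c1) < e / 3" "norm (q - D x c2) < e / 3"
          using \<delta>(4)[of h] \<delta>(5)[of h] \<delta>(6)[of h] h by (auto simp: scaleR_add_right)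
        then show ?thesis by norm
      qed
      then have "norm (D x (c1 + c2) - (D x c1 + D x c2)) \<le> 0"
        by (rule field_le_epsilon)
      then show ?thesis by simp
    qed
    have L: "0 \<le> L" using S(2) by (rule lipschitz_on_nonneg)
    have lip: "norm (D x c - D x d) \<le> L * norm (c - d)" for c d
      by (rule has_dir_deriv_diff_le[OF S(1) \<open>x \<in> S\<close> S(2)]) (use deriv \<open>x \<in> S\<close> in auto)
    have "norm (D x (d1 + d2) - (D x d1 + D x d2)) \<le> 0 + e" if "e > 0" for e
    proof -
      define r where "r = e / (4 * (L + 1))"
      have "r > 0" using that L by (simp add: r_def)
      have Lr: "L * r \<le> e / 4" using that L by (simp add: r_def field_simps)
      obtain c1 c2 where c: "c1 \<in> C" "c2 \<in> C" "c1 \<in> ball d1 r" "c2 \<in> ball d2 r"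
        using C(2)[of "ball d1 r"] C(2)[of "ball d2 r"] \<open>r > 0\<close> by auto
      have r: "norm (d1 - c1) < r" "norm (d2 - c2) < r" using c by (auto simp: dist_norm)
      have "norm (D x d1 - D x c1) \<le> e / 4" "norm (D x d2 - D x c2) \<le> e / 4"
        using lip[of d1 c1] lip[of d2 c2] mult_left_mono[OF less_imp_le[OF r(1)] L]
          mult_left_mono[OF less_imp_le[OF r(2)] L] Lr by linarith+
      moreover have "norm (D x (d1 + d2) - D x (c1 + c2)) \<le> 2 * (e / 4)"
      proof -
        have "norm ((d1 + d2) - (c1 + c2)) \<le> 2 * r" using r by norm
        then have "L * norm ((d1 + d2) - (c1 + c2)) \<le> L * (2 * r)" using L by (rule mult_left_mono)
        with lip[of "d1 + d2" "c1 + c2"] Lr show ?thesis by linarith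
      qed
      moreover have eq: "D x (d1 + d2) - (D x d1 + D x d2)
          = (D x (d1 + d2) - D x (c1 + c2)) - ((D x d1 - D x c1) + (D x d2 - D x c2))"
        using dense[OF c(1,2)] by simp
      ultimately show ?thesis
        unfolding eq
        using norm_triangle_ineq4[of "D x (d1 + d2) - D x (c1 + c2)" "(D x d1 - D x c1) + (D x d2 - D x c2)"]
          norm_triangle_ineq[of "D x d1 - D x c1" "D x d2 - D x c2"] by linarith
    qed
    then have "norm (D x (d1 + d2) - (D x d1 + D x d2)) \<le> 0" by (rule field_le_epsilon)
    then show "D x (d1 + d2) = D x d1 + D x d2" by simp
  qed
qed

text \<open>In finite dimension the Hadamard property and compactness of the unit sphere make a linear one-sided
  derivative a Frechet derivative.\<close>

lemma has_derivative_of_linear_dir_deriv: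
  fixes H :: "'a::euclidean_space \<Rightarrow> 'b::real_normed_vector"
  assumes S: "open S" "x \<in> S" "L-lipschitz_on S H"
    and deriv: "\<And>d. has_dir_deriv H x d (D d)" and "linear D"
  shows "(H has_derivative D) (at x)"
  unfolding has_derivative_at_alt
proof (intro conjI allI impI)
  show "bounded_linear D" using \<open>linear D\<close> by (rule linear_linear[THEN iffD2] linear_conv_bounded_linear[THEN iffD1])
  interpret D: linear D by fact
  fix e :: real assume "e > 0"
  show "\<exists>\<delta>>0. \<forall>y. norm (y - x) < \<delta> \<longrightarrow> norm (H y - H x - D (y - x)) \<le> e * norm (y - x)"
  proof (rule ccontr)
    assume "\<not> ?thesis"
    then have "\<forall>k. \<exists>y. norm (y - x) < inverse (real (Suc k)) \<and> \<not> norm (H y - H x - D (y - x)) \<le> e * norm (y - x)"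
      by (metis inverse_positive_iff_positive of_nat_0_less_iff zero_less_Suc)
    then obtain y where y: "\<And>k. norm (y k - x) < inverse (real (Suc k))"
      "\<And>k. \<not> norm (H (y k) - H x - D (y k - x)) \<le> e * norm (y k - x)" by metis
    define t where "t k = norm (y k - x)" for k
    define u where "u k = (y k - x) /\<^sub>R t k" for k
    have t_pos: "t k > 0" for k
    proof (rule ccontr)
      assume "\<not> t k > 0"
      then have "y k = x" by (simp add: t_def)
      then show False using y(2)[of k] D.zero by simp
    qed
    have t0: "t \<longlonglongrightarrow> 0"
      by (rule LIMSEQ_norm_0) (use y(1) in \<open>simp add: t_def inverse_eq_divide\<close>)
    have "u k \<in> sphere 0 1" for k using t_pos[of k] by (simp add: u_def t_def)
    then obtain v r where r: "strict_mono r" "(u \<circ> r) \<longlonglongrightarrow> v"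
      using compact_sphere[of "0::'a" 1] unfolding compact_def by metis
    have y_eq: "y k = x + t k *\<^sub>R u k" for k using t_pos[of k] by (simp add: u_def)
    have "(\<lambda>k. (H (x + (t \<circ> r) k *\<^sub>R (u \<circ> r) k) - H x) /\<^sub>R (t \<circ> r) k) \<longlonglongrightarrow> D v"
      by (rule has_dir_deriv_sequentially_variable_direction[OF S deriv])
        (use t_pos r(2) LIMSEQ_subseq_LIMSEQ[OF t0 r(1)] in \<open>simp_all del: o_apply, simp\<close>)
    moreover have "(\<lambda>k. D ((u \<circ> r) k)) \<longlonglongrightarrow> D v"
      using linear_continuous_on[OF \<open>bounded_linear D\<close>, of UNIV] r(2)
      by (metis UNIV_I continuous_on_tendsto_compose eventually_sequentially)
    ultimately have "(\<lambda>k. (H (x + (t \<circ> r) k *\<^sub>R (u \<circ> r) k) - H x) /\<^sub>R (t \<circ> r) k - D ((u \<circ> r) k)) \<longlonglongrightarrow> D v - D v"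
      by (rule tendsto_diff)
    then have "\<forall>\<^sub>F k in sequentially. norm ((H (x + (t \<circ> r) k *\<^sub>R (u \<circ> r) k) - H x) /\<^sub>R (t \<circ> r) k - D ((u \<circ> r) k)) < e"
      using \<open>e > 0\<close> tendstoD[of _ 0] by (fastforce simp: dist_norm)
    then obtain k where k: "norm ((H (x + t k *\<^sub>R u k) - H x) /\<^sub>R t k - D (u k)) < e"
      by (auto simp: eventually_sequentially)
    have "H (y k) - H x - D (y k - x) = t k *\<^sub>R ((H (x + t k *\<^sub>R u k) - H x) /\<^sub>R t k - D (u k))"
      using t_pos[of k] by (simp add: y_eq scaleR_diff_right D.scale)
    then have "norm (H (y k) - H x - D (y k - x)) = t k * norm ((H (x + t k *\<^sub>R u k) - H x) /\<^sub>R t k - D (u k))"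
      using t_pos[of k] by simp
    also have "\<dots> \<le> t k * e" using k t_pos[of k] by (intro mult_left_mono) auto
    finally show False using y(2)[of k] by (simp add: t_def mult.commute)
  qed
qed

text \<open>Rademacher's theorem under the additional assumption that one-sided directional derivatives exist
  everywhere. Their positive homogeneity is automatic, so almost everywhere additivity is all that
  linearity requires.\<close>

lemma negligible_not_has_derivative_dir_deriv:
  fixes H :: "'a::euclidean_space \<Rightarrow> 'b::euclidean_space"
  assumes S: "open S" "L-lipschitz_on S H"
    and deriv: "\<And>z d. z \<in> S \<Longrightarrow> has_dir_deriv H z d (D z d)"
  shows "negligible {x\<in>S. \<not> (H has_derivative D x) (at x)}"
proof -
  have "negligible {x\<in>cbox a b. \<not> (H has_derivative D x) (at x)}" if ab: "cbox a b \<subseteq> S" for a b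
  proof -
    obtain N where N: "negligible N"
      "\<And>x d1 d2. x \<in> box a b - N \<Longrightarrow> D x (d1 + d2) = D x d1 + D x d2"
      using has_dir_deriv_additive_ae[OF S deriv ab] by metis
    have "(H has_derivative D x) (at x)" if x: "x \<in> box a b - N" for x
    proof (rule has_derivative_of_linear_dir_deriv[OF S(1) _ S(2)])
      show "x \<in> S" using x ab box_subset_cbox by blast
      then show D: "has_dir_deriv H x d (D x d)" for d by (rule deriv)
      have zero: "D x 0 = 0" using has_dir_deriv_unique[OF D has_dir_deriv_zero] .
      have neg: "D x (- d) = - D x d" for d
        using N(2)[OF x, of d "- d"] zero by (simp add: eq_neg_iff_add_eq_0 add.commute)
      have pos: "D x (c *\<^sub>R d) = c *\<^sub>R D x d" if "c \<ge> 0" for c d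
        using has_dir_deriv_unique[OF D has_dir_deriv_scaleR[OF D that]] .
      have "D x (c *\<^sub>R d) = c *\<^sub>R D x d" for c d
        using pos[of c d] pos[of "- c" d] neg[of "c *\<^sub>R d"] by (cases "c \<ge> 0") auto
      then show "linear (D x)" using N(2)[OF x] by (intro linearI) auto
    qed
    then have "{x\<in>cbox a b. \<not> (H has_derivative D x) (at x)} \<subseteq> N \<union> (cbox a b - box a b)" by blast
    then show ?thesis using N(1) negligible_frontier_interval negligible_subset negligible_Un by blast
  qed
  moreover obtain \<D> where \<D>: "countable \<D>" "\<D> \<subseteq> Pow S" "\<And>X. X \<in> \<D> \<Longrightarrow> \<exists>a b. X = cbox a b" "\<Union>\<D> = S"
    using open_countable_Union_open_cbox[OF S(1)] by metis
  ultimately have "negligible {x\<in>X. \<not> (H has_derivative D x) (at x)}" if "X \<in> \<D>" for X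
    using that by blast
  then have "negligible (\<Union>X\<in>\<D>. {x\<in>X. \<not> (H has_derivative D x) (at x)})"
    using \<D>(1) by (intro negligible_countable_Union) auto
  then show ?thesis
    by (rule negligible_subset) (use \<D>(4) in blast)
qed

section \<open>Semismoothness and the Newton remainder\<close>

text \<open>The derivative hypothesis is only needed off a null set, because the averages \<open>F\<close> over small
  boxes satisfy it, scaled by the volume, at every point of the segment. As the box shrinks to a point, \<open>F\<close> divided by the volume of
  the box tends to \<open>H\<close> uniformly on the segment.\<close>

lemma norm_increment_le_of_dir_deriv_near_ae:
  fixes H :: "'a::euclidean_space \<Rightarrow> 'b::euclidean_space"
  assumes S: "open S" "L-lipschitz_on S H"
    and deriv: "\<And>z. z \<in> S \<Longrightarrow> has_dir_deriv H z d (D z)"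
    and seg: "\<And>s. 0 \<le> s \<Longrightarrow> s \<le> 1 \<Longrightarrow> x + s *\<^sub>R d \<in> S"
    and N: "negligible N" "\<And>z. z \<in> S - N \<Longrightarrow> norm (D z - c) \<le> e" and "0 \<le> e"
  shows "norm (H (x + d) - H x - c) \<le> e"
proof (rule field_le_epsilon)
  fix \<eta> :: real assume "\<eta> > 0"
  let ?K = "(\<lambda>s. x + s *\<^sub>R d) ` {0..1}"
  have L: "0 \<le> L" using S(2) by (rule lipschitz_on_nonneg)
  have "compact ?K" by (intro compact_continuous_image continuous_intros compact_Icc)
  moreover have "?K \<subseteq> S" using seg by auto
  ultimately obtain \<epsilon> where "\<epsilon> > 0" and \<epsilon>: "(\<Union>z\<in>?K. ball z \<epsilon>) \<subseteq> S"
    using compact_subset_open_imp_ball_epsilon_subset S(1) by metis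
  define r where "r = min (\<epsilon> / 2) (\<eta> / (2 * (L + 1)))"
  have r: "r > 0" "r < \<epsilon>" using \<open>\<epsilon> > 0\<close> \<open>\<eta> > 0\<close> L by (auto simp: r_def)
  have "r * (2 * (L + 1)) \<le> \<eta>"
    using L by (simp add: r_def flip: pos_le_divide_eq)
  moreover have "2 * (L * r) \<le> r * (2 * (L + 1))" using r(1) by (simp add: algebra_simps)
  ultimately have Lr: "2 * (L * r) \<le> \<eta>" by linarith
  \<comment> \<open>A cube of half side \<open>r / n\<close> lies in the ball of radius \<open>r\<close>, by the \<open>l\<^sup>1\<close> bound on the norm.\<close>
  define \<rho> where "\<rho> = r / DIM('a)"
  have "\<rho> > 0" using r by (simp add: \<rho>_def)
  define Q where "Q = cbox (- (\<rho> *\<^sub>R One)) (\<rho> *\<^sub>R One :: 'a)"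
  define V where "V = measure lborel Q"
  have "V > 0"
    unfolding V_def Q_def by (rule content_pos_lt) (use \<open>\<rho> > 0\<close> in simp)
  have Q_small: "norm y \<le> r" if "y \<in> Q" for y
  proof -
    have "norm y \<le> (\<Sum>i\<in>Basis. \<bar>y \<bullet> i\<bar>)" by (rule norm_le_l1)
    also have "\<dots> \<le> (\<Sum>i\<in>(Basis::'a set). \<rho>)"
      using that by (intro sum_mono) (auto simp: Q_def mem_box abs_le_iff)
    finally show ?thesis by (simp add: \<rho>_def)
  qed
  have inS: "z + y \<in> S" if "z \<in> ?K" "y \<in> Q" for z y
  proof -
    have "z + y \<in> ball z \<epsilon>" using Q_small[OF that(2)] r by (simp add: dist_norm)
    then show ?thesis using \<epsilon> that(1) by blast
  qed
  define F where "F z = integral Q (\<lambda>y. H (z + y))" for z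
  have Fderiv: "(\<lambda>y. D (z + y)) integrable_on Q"
    "has_dir_deriv F z d (integral Q (\<lambda>y. D (z + y)))" if "z \<in> ?K" for z
    unfolding F_def[abs_def] Q_def
    by (rule mollified_has_dir_deriv[OF S _ deriv], use inS[OF that] in \<open>simp add: Q_def\<close>, assumption)+
  have Fdiff: "norm (integral Q (\<lambda>y. D (z + y)) - V *\<^sub>R c) \<le> V * e" if "z \<in> ?K" for z
  proof -
    \<comment> \<open>Redefining the integrand on the null set makes the bound hold everywhere on the box.\<close>
    define g where "g y = (if z + y \<in> N then c else D (z + y)) - c" for y
    have neg: "negligible ((+) (- z) ` N)" using N(1) by (rule negligible_translation)
    have "((\<lambda>y. D (z + y) - c) has_integral (integral Q (\<lambda>y. D (z + y)) - V *\<^sub>R c)) Q"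
      using has_integral_diff[OF integrable_integral[OF Fderiv(1)[OF that]], of "\<lambda>_. c"] 
        has_integral_const[of c "- (\<rho> *\<^sub>R One)" "\<rho> *\<^sub>R One :: 'a"]
      by (simp add: V_def Q_def)
    then have "(g has_integral (integral Q (\<lambda>y. D (z + y)) - V *\<^sub>R c)) Q"
      by (rule has_integral_spike[OF neg, rotated]) (auto simp: g_def image_iff algebra_simps)
    then have "norm (integral Q (\<lambda>y. D (z + y)) - V *\<^sub>R c) \<le> e * measure lborel Q"
      unfolding Q_def
      by (rule has_integral_bound[OF \<open>0 \<le> e\<close>])
        (use N(2) inS[OF that] \<open>0 \<le> e\<close> in \<open>auto simp: g_def Q_def\<close>)
    then show ?thesis by (simp add: V_def mult.commute)
  qed
  have "norm (F (x + d) - F x - V *\<^sub>R c) \<le> V * e"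
  proof (rule norm_increment_le_of_dir_deriv_near)
    show "continuous_on ?K F"
      unfolding F_def[abs_def] Q_def
      by (rule lipschitz_on_continuous_on, rule mollified_lipschitz[OF S(2)]) (use inS in \<open>auto simp: Q_def\<close>)
    fix s :: real assume "0 \<le> s" "s < 1"
    then have "x + s *\<^sub>R d \<in> ?K" by auto
    then show "\<exists>v. has_dir_deriv F (x + s *\<^sub>R d) d v \<and> norm (v - V *\<^sub>R c) \<le> V * e"
      using Fderiv(2) Fdiff by blast
  qed
  moreover have F_approx: "norm (F z - V *\<^sub>R H z) \<le> V * (L * r)" if z: "z \<in> ?K" for z
  proof -
    have int: "(\<lambda>y. H (z + y)) integrable_on Q"
      unfolding Q_def
      by (intro integrable_continuous continuous_on_compose2[OF lipschitz_on_continuous_on[OF S(2)]]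
          continuous_intros) (use inS[OF z] in \<open>auto simp: Q_def\<close>)
    have "z \<in> S" using z seg by auto
    have "norm (integral Q (\<lambda>y. H (z + y) - H z)) \<le> (L * r) * measure lborel Q"
      unfolding Q_def
    proof (rule integrable_bound)
      show "(\<lambda>y. H (z + y) - H z) integrable_on cbox (- (\<rho> *\<^sub>R One)) (\<rho> *\<^sub>R One)"
        using int unfolding Q_def by (intro integrable_diff integrable_const)
      show "norm (H (z + y) - H z) \<le> L * r" if "y \<in> cbox (- (\<rho> *\<^sub>R One)) (\<rho> *\<^sub>R One)" for y
      proof -
        have "y \<in> Q" using that by (simp add: Q_def)
        have "norm (H (z + y) - H z) \<le> L * norm y"
          using lipschitz_onD[OF S(2) inS[OF z \<open>y \<in> Q\<close>] \<open>z \<in> S\<close>] by (simp add: dist_norm)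
        also have "\<dots> \<le> L * r" using Q_small[OF \<open>y \<in> Q\<close>] L by (rule mult_left_mono)
        finally show ?thesis .
      qed
    qed (use L r in simp)
    moreover have "integral Q (\<lambda>y. H (z + y) - H z) = F z - V *\<^sub>R H z"
      using int unfolding F_def V_def Q_def by (subst integral_diff) auto
    ultimately show ?thesis by (simp add: V_def mult.commute)
  qed
  moreover have "x \<in> ?K" by (auto intro!: image_eqI[of _ _ 0])
  moreover have "x + d \<in> ?K" by (auto intro!: image_eqI[of _ _ 1])
  moreover have "V *\<^sub>R (H (x + d) - H x - c)
      = (F (x + d) - F x - V *\<^sub>R c) + ((F x - V *\<^sub>R H x) - (F (x + d) - V *\<^sub>R H (x + d)))"
    by (simp add: algebra_simps)
  ultimately have "norm (V *\<^sub>R (H (x + d) - H x - c)) \<le> V * e + (V * (L * r) + V * (L * r))"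
    by (metis add_mono norm_triangle_le norm_triangle_le_diff)
  also have "\<dots> = V * (e + 2 * (L * r))" by (simp add: algebra_simps)
  also have "\<dots> \<le> V * (e + \<eta>)" using Lr \<open>V > 0\<close> by (intro mult_left_mono) auto
  finally show "norm (H (x + d) - H x - c) \<le> e + \<eta>" using \<open>V > 0\<close> by simp
qed

text \<open>The constant sequence at a point of differentiability witnesses membership in the
  B-subdifferential.\<close>

lemma jacobian_in_clarke_jacobian:
  assumes "H differentiable (at x)"
  shows "jacobian H (at x) \<in> clarke_jacobian H x"
  unfolding clarke_jacobian_def
proof (rule hull_inc)
  show "jacobian H (at x) \<in> B_subdifferential H x"
    unfolding B_subdifferential_def mem_Collect_eq using assms by (intro exI[of _ "\<lambda>_. x"]) simp
qed

text \<open>The estimate behind superlinear convergence. Semismoothness, the Lipschitz estimate for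
  \<open>D y\<close> and compactness of the unit sphere give a uniform radius \<open>\<delta>\<close> such that for every unit vector
  \<open>h\<close> there is a vector \<open>l\<close> with \<open>\<parallel>D y h - l\<parallel> \<le> \<epsilon> / 2\<close> for almost every \<open>y\<close> in a conical neighbourhood
  \<open>W\<close> of the ray from \<open>xbar\<close> in direction \<open>h\<close>. For \<open>x = xbar + t *\<^sub>R h\<close> the almost everywhere mean
  value inequality bounds \<open>H x - H (xbar + s *\<^sub>R h) - (t - s) *\<^sub>R l\<close> by \<open>(t - s) * (\<epsilon> / 2)\<close>; letting
  \<open>s\<close> increase to \<open>t\<close> shows that \<open>D x (- h)\<close> is close to \<open>- l\<close>, and letting \<open>s\<close> decrease to \<open>0\<close>
  shows that \<open>H x - H xbar\<close> is close to \<open>t *\<^sub>R l\<close>.\<close>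

lemma semismooth_newton_remainder:
  fixes H :: "real^'n \<Rightarrow> real^'m"
  assumes S: "open S" "xbar \<in> S" "L-lipschitz_on S H"
    and deriv: "\<And>z d. z \<in> S \<Longrightarrow> has_dir_deriv H z d (D z d)"
    and ss: "semismooth_at H xbar" and "\<epsilon> > 0"
  shows "\<exists>\<delta>>0. \<forall>x\<in>ball xbar \<delta>. norm (H x - H xbar + D x (xbar - x)) \<le> \<epsilon> * norm (x - xbar)"
proof -
  have L: "0 \<le> L" using S(3) by (rule lipschitz_on_nonneg)
  define N where "N = {x\<in>S. \<not> (H has_derivative D x) (at x)}"
  have N: "negligible N"
    unfolding N_def by (rule negligible_not_has_derivative_dir_deriv[OF S(1,3) deriv])
  have scale: "D z (c *\<^sub>R d) = c *\<^sub>R D z d" if "z \<in> S" "c \<ge> 0" for z c d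
    using has_dir_deriv_unique[OF deriv has_dir_deriv_scaleR[OF deriv]] that by blast
  have "\<exists>l \<eta> \<tau>. \<eta> > 0 \<and> \<tau> > 0 \<and> (\<forall>h t. dist h z < \<eta> \<longrightarrow> 0 < t \<longrightarrow> t < \<tau> \<longrightarrow>
      (\<forall>A\<in>clarke_jacobian H (xbar + t *\<^sub>R h). dist (A *v h) l < \<epsilon> / 4))" for z
  proof -
    obtain l where "\<forall>\<^sub>F (h, t) in nhds z \<times>\<^sub>F at_right 0.
        \<forall>A\<in>clarke_jacobian H (xbar + t *\<^sub>R h). dist (A *v h) l < \<epsilon> / 4"
      using ss \<open>\<epsilon> > 0\<close> unfolding semismooth_at_def by (meson zero_less_divide_iff zero_less_numeral)
    then obtain P R where "eventually P (nhds z)" "eventually R (at_right 0)"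
      "\<And>h t. P h \<Longrightarrow> R t \<Longrightarrow> \<forall>A\<in>clarke_jacobian H (xbar + t *\<^sub>R h). dist (A *v h) l < \<epsilon> / 4"
      unfolding eventually_prod_filter by auto
    then show ?thesis
      unfolding eventually_nhds_metric eventually_at_right_field by metis
  qed
  then obtain l \<eta> \<tau> where \<eta>: "\<And>z. \<eta> z > 0" and \<tau>: "\<And>z. \<tau> z > 0"
    and near: "\<And>z h t A. dist h z < \<eta> z \<Longrightarrow> 0 < t \<Longrightarrow> t < \<tau> z \<Longrightarrow>
      A \<in> clarke_jacobian H (xbar + t *\<^sub>R h) \<Longrightarrow> dist (A *v h) (l z) < \<epsilon> / 4"
    by metis
  obtain Z where Z: "finite Z" "sphere 0 1 \<subseteq> (\<Union>z\<in>Z. ball z (\<eta> z / 2))"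
  proof (rule compactE_image[of "sphere (0::real^'n) 1" UNIV "\<lambda>z. ball z (\<eta> z / 2)"])
    show "sphere 0 1 \<subseteq> (\<Union>z. ball z (\<eta> z / 2))"
    proof
      fix h :: "real^'n"
      have "h \<in> ball h (\<eta> h / 2)" using \<eta>[of h] by simp
      then show "h \<in> (\<Union>z. ball z (\<eta> z / 2))" by blast
    qed
  qed auto
  obtain r where r: "r > 0" "ball xbar r \<subseteq> S" using S openE by blast
  define \<delta> where "\<delta> = Min (insert r (\<tau> ` Z))"
  have "\<delta> > 0" "\<delta> \<le> r" and \<delta>: "\<And>z. z \<in> Z \<Longrightarrow> \<delta> \<le> \<tau> z"
    using Z(1) r \<tau> by (auto simp: \<delta>_def)
  have main: "norm (H x - H xbar + D x (xbar - x)) \<le> \<epsilon> * norm (x - xbar)"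
    if x: "x \<in> ball xbar \<delta>" "x \<noteq> xbar" for x
  proof -
    define t h where "t = norm (x - xbar)" "h = (x - xbar) /\<^sub>R t"
    have t: "0 < t" "t < \<delta>" using x by (auto simp: t_h_def dist_norm norm_minus_commute)
    have h: "norm h = 1" and x_eq: "x = xbar + t *\<^sub>R h"
      using t by (auto simp: t_h_def)
    obtain z where z: "z \<in> Z" "dist h z < \<eta> z / 2"
      using Z(2) h by (auto simp: dist_commute)
    define \<eta>' where "\<eta>' = min (\<eta> z / 2) (\<epsilon> / (4 * (L + 1)))"
    have "\<eta>' > 0" using \<eta>[of z] \<open>\<epsilon> > 0\<close> L by (simp add: \<eta>'_def)
    have "\<eta>' * (4 * (L + 1)) \<le> \<epsilon>"
      using L by (simp add: \<eta>'_def flip: pos_le_divide_eq)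
    moreover have "4 * (L * \<eta>') \<le> \<eta>' * (4 * (L + 1))" using \<open>\<eta>' > 0\<close> by (simp add: algebra_simps)
    ultimately have L\<eta>': "L * \<eta>' \<le> \<epsilon> / 4" by linarith
    \<comment> \<open>The radius proportional to \<open>s\<close> makes \<open>W\<close> conical: rescaled points of \<open>W\<close> stay close to \<open>h\<close>.\<close>
    define W where "W = (\<Union>s\<in>{0<..<\<delta>}. ball (xbar + s *\<^sub>R h) (s * \<eta>')) \<inter> S"
    have W: "open W" "W \<subseteq> S" using S(1) by (auto simp: W_def)
    have rayS: "xbar + s *\<^sub>R h \<in> S" if "0 \<le> s" "s < \<delta>" for s
    proof -
      have "xbar + s *\<^sub>R h \<in> ball xbar r" using that h \<open>\<delta> \<le> r\<close> by (simp add: dist_norm)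
      then show ?thesis using r(2) by blast
    qed
    have rayW: "xbar + s *\<^sub>R h \<in> W" if "0 < s" "s < \<delta>" for s
      using rayS[of s] that \<open>\<eta>' > 0\<close> by (auto simp: W_def intro!: bexI[of _ s])
    have Dh: "norm (D y h - l z) \<le> \<epsilon> / 2" if y: "y \<in> W - N" for y
    proof -
      obtain s where s: "0 < s" "s < \<delta>" "y \<in> ball (xbar + s *\<^sub>R h) (s * \<eta>')"
        using y by (auto simp: W_def)
      define h' where "h' = (y - xbar) /\<^sub>R s"
      have y_eq: "y = xbar + s *\<^sub>R h'" using s by (simp add: h'_def)
      have "norm (s *\<^sub>R (h - h')) < s * \<eta>'"
        using s(3) by (simp add: y_eq dist_norm scaleR_diff_right)
      then have hh': "norm (h - h') < \<eta>'" using s by simp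
      have "dist h' z \<le> dist h h' + dist h z" by (metis dist_commute dist_triangle)
      then have h'z: "dist h' z < \<eta> z"
        using z(2) hh' by (simp add: \<eta>'_def dist_norm)
      have der: "(H has_derivative D y) (at y)" "y \<in> S" using y W by (auto simp: N_def)
      then have "H differentiable (at y)" by (auto simp: differentiable_def)
      then have jac: "(H has_derivative (\<lambda>h. jacobian H (at y) *v h)) (at y)"
        by (simp add: jacobian_works)
      have "dist (jacobian H (at y) *v h') (l z) < \<epsilon> / 4"
        using near[OF h'z s(1), of "jacobian H (at y)"] s(2) \<delta>[OF z(1)]
          jacobian_in_clarke_jacobian[OF \<open>H differentiable (at y)\<close>] by (simp add: y_eq)
      moreover have "jacobian H (at y) *v h' = D y h'"
        using has_derivative_unique[OF jac der(1)] by metis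
      moreover have "norm (D y h - D y h') \<le> L * norm (h - h')"
        by (rule has_dir_deriv_diff_le[OF S(1) der(2) S(3)]) (use deriv der(2) in auto)
      moreover have "L * norm (h - h') \<le> L * \<eta>'" using hh' L by (intro mult_left_mono) auto
      ultimately show ?thesis
        using L\<eta>' norm_triangle_ineq[of "D y h - D y h'" "D y h' - l z"] by (simp add: dist_norm)
    qed
    have inc: "norm (H x - H (xbar + s *\<^sub>R h) - (t - s) *\<^sub>R l z) \<le> (t - s) * (\<epsilon> / 2)" if s: "0 < s" "s < t" for s
    proof -
      have "norm (H (xbar + s *\<^sub>R h + (t - s) *\<^sub>R h) - H (xbar + s *\<^sub>R h) - (t - s) *\<^sub>R l z) \<le> (t - s) * (\<epsilon> / 2)"
      proof (rule norm_increment_le_of_dir_deriv_near_ae[OF W(1) lipschitz_on_subset[OF S(3) W(2)] _ _ N])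
        show "has_dir_deriv H y ((t - s) *\<^sub>R h) (D y ((t - s) *\<^sub>R h))" if "y \<in> W" for y
          using deriv that W by blast
        show "xbar + s *\<^sub>R h + u *\<^sub>R (t - s) *\<^sub>R h \<in> W" if "0 \<le> u" "u \<le> 1" for u
        proof -
          have "u * (t - s) \<le> t - s" using that s by (simp add: mult_left_le_one_le)
          then have "s + u * (t - s) < \<delta>" using t by linarith
          then have "xbar + (s + u * (t - s)) *\<^sub>R h \<in> W"
            using that s by (intro rayW add_pos_nonneg) auto
          then show ?thesis by (simp add: scaleR_add_left add.assoc)
        qed
        show "norm (D y ((t - s) *\<^sub>R h) - (t - s) *\<^sub>R l z) \<le> (t - s) * (\<epsilon> / 2)" if "y \<in> W - N" for y
        proof -
          have "D y ((t - s) *\<^sub>R h) - (t - s) *\<^sub>R l z = (t - s) *\<^sub>R (D y h - l z)"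
            using scale[of y "t - s" h] that W s by (auto simp: scaleR_diff_right)
          then show ?thesis using Dh[OF that] s by simp
        qed
      qed (use s \<open>\<epsilon> > 0\<close> in simp)
      moreover have "xbar + s *\<^sub>R h + (t - s) *\<^sub>R h = x"
        by (simp add: x_eq algebra_simps)
      ultimately show ?thesis by simp
    qed
    have "x \<in> S" using rayS[of t] t x_eq by simp
    have "norm (D x (- h) + l z) \<le> \<epsilon> / 2"
    proof (rule tendsto_upperbound)
      show "((\<lambda>u. norm ((H (x + u *\<^sub>R (- h)) - H x) /\<^sub>R u + l z)) \<longlongrightarrow> norm (D x (- h) + l z)) (at_right 0)"
        using deriv[OF \<open>x \<in> S\<close>, of "- h"] unfolding has_dir_deriv_def by (intro tendsto_intros)
      have "\<forall>\<^sub>F u in at_right 0. u \<in> {0<..<t}" using t by (intro eventually_at_right_real)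
      then show "\<forall>\<^sub>F u in at_right 0. norm ((H (x + u *\<^sub>R (- h)) - H x) /\<^sub>R u + l z) \<le> \<epsilon> / 2"
      proof eventually_elim
        case (elim u)
        have "x + u *\<^sub>R (- h) = xbar + (t - u) *\<^sub>R h" by (simp add: x_eq algebra_simps)
        then have "norm (- (H x - H (x + u *\<^sub>R (- h)) - u *\<^sub>R l z)) \<le> u * (\<epsilon> / 2)"
          using inc[of "t - u"] elim unfolding norm_minus_cancel by simp
        moreover have "- (H x - H (x + u *\<^sub>R (- h)) - u *\<^sub>R l z) = u *\<^sub>R ((H (x + u *\<^sub>R (- h)) - H x) /\<^sub>R u + l z)"
          using elim by (simp add: scaleR_add_right)
        ultimately show ?case using elim by (simp only: norm_scaleR) simp
      qed
    qed simp
    moreover have "norm (H x - H xbar - t *\<^sub>R l z) \<le> t * (\<epsilon> / 2)"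
    proof (rule tendsto_le[of "at_right 0"])
      have "isCont H xbar"
        using lipschitz_on_continuous_on[OF S(3)] S(1,2) continuous_on_eq_continuous_at by blast
      moreover have "((\<lambda>s. xbar + s *\<^sub>R h) \<longlongrightarrow> xbar + 0 *\<^sub>R h) (at_right 0)"
        by (intro tendsto_intros)
      ultimately have "((\<lambda>s. H (xbar + s *\<^sub>R h)) \<longlongrightarrow> H xbar) (at_right 0)"
        using isCont_tendsto_compose by fastforce
      then have "((\<lambda>s. norm (H x - H (xbar + s *\<^sub>R h) - (t - s) *\<^sub>R l z))
          \<longlongrightarrow> norm (H x - H xbar - (t - 0) *\<^sub>R l z)) (at_right 0)"
        by (intro tendsto_intros)
      then show "((\<lambda>s. norm (H x - H (xbar + s *\<^sub>R h) - (t - s) *\<^sub>R l z))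
          \<longlongrightarrow> norm (H x - H xbar - t *\<^sub>R l z)) (at_right 0)" by simp
      have "((\<lambda>s. (t - s) * (\<epsilon> / 2)) \<longlongrightarrow> (t - 0) * (\<epsilon> / 2)) (at_right 0)"
        by (intro tendsto_intros)
      then show "((\<lambda>s. (t - s) * (\<epsilon> / 2)) \<longlongrightarrow> t * (\<epsilon> / 2)) (at_right 0)" by simp
      show "\<forall>\<^sub>F s in at_right 0. norm (H x - H (xbar + s *\<^sub>R h) - (t - s) *\<^sub>R l z) \<le> (t - s) * (\<epsilon> / 2)"
        using eventually_at_right_real[OF t(1)]
      proof eventually_elim
        case (elim s)
        then show ?case by (intro inc) auto
      qed
    qed simp
    moreover have "D x (xbar - x) = t *\<^sub>R D x (- h)"
      using scale[OF \<open>x \<in> S\<close>, of t "- h"] t by (simp add: x_eq)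
    then have "H x - H xbar + D x (xbar - x) = (H x - H xbar - t *\<^sub>R l z) + t *\<^sub>R (D x (- h) + l z)"
      by (simp add: scaleR_add_right)
    moreover have "norm (t *\<^sub>R (D x (- h) + l z)) = t * norm (D x (- h) + l z)" using t by simp
    ultimately have "norm (H x - H xbar + D x (xbar - x)) \<le> t * (\<epsilon> / 2) + t * (\<epsilon> / 2)"
      using t(1) by (metis add_mono mult_left_mono less_imp_le norm_triangle_le)
    then show ?thesis by (simp add: t_h_def mult.commute)
  qed
  have "D xbar 0 = 0"
    using has_dir_deriv_unique[OF deriv[OF S(2)] has_dir_deriv_zero] .
  then have "norm (H x - H xbar + D x (xbar - x)) \<le> \<epsilon> * norm (x - xbar)" if "x \<in> ball xbar \<delta>" for x
    using main[OF that] by (cases "x = xbar") auto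
  then show ?thesis using \<open>\<delta> > 0\<close> by blast
qed

section \<open>Metric regularity and expansion\<close>

text \<open>Metric regularity provides a solution \<open>u'\<close> of \<open>H u' = H u\<close> at distance about
  \<open>\<mu> \<parallel>H x - H u\<parallel>\<close> from \<open>x\<close>. For \<open>x\<close> and \<open>u\<close> close to \<open>xbar\<close> this solution still lies in the region of
  injectivity, so it is \<open>u\<close> itself.\<close>

lemma locally_expanding_of_metrically_regular:
  fixes H :: "'a::real_normed_vector \<Rightarrow> 'b::real_normed_vector"
  assumes "isCont H xbar" "one_to_one_around H xbar" "metrically_regular_around H xbar"
  shows "\<exists>r>0. \<exists>\<mu>>0. \<forall>x\<in>ball xbar r. \<forall>u\<in>ball xbar r. norm (x - u) \<le> \<mu> * norm (H x - H u)"
proof -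
  obtain U V \<mu> where \<mu>: "\<mu> > 0" and UV: "open U" "xbar \<in> U" "open V" "H xbar \<in> V"
    and reg: "\<And>x y. x \<in> U \<Longrightarrow> y \<in> V \<Longrightarrow> set_dist x (H -` {y}) \<le> ereal (\<mu> * norm (y - H x))"
    using assms(3) unfolding metrically_regular_around_def by blast
  obtain W where W: "open W" "xbar \<in> W" "inj_on H W"
    using assms(2) unfolding one_to_one_around_def by blast
  obtain \<rho> where \<rho>: "\<rho> > 0" "ball xbar \<rho> \<subseteq> U \<inter> W"
    using UV W by (meson IntI open_Int openE)
  obtain \<sigma> where \<sigma>: "\<sigma> > 0" "ball (H xbar) \<sigma> \<subseteq> V" using UV openE by blast
  have "min \<sigma> (\<rho> / (4 * \<mu>)) > 0" using \<sigma> \<rho> \<mu> by simp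
  then obtain s where s: "s > 0" "\<And>x. dist x xbar < s \<Longrightarrow> dist (H x) (H xbar) < min \<sigma> (\<rho> / (4 * \<mu>))"
    using assms(1) unfolding continuous_at_eps_delta by metis
  define r where "r = min s (\<rho> / 2)"
  have "norm (x - u) \<le> \<mu> * norm (H x - H u)" if xu: "x \<in> ball xbar r" "u \<in> ball xbar r" for x u
  proof -
    have dx: "dist x xbar < s" "dist x xbar < \<rho> / 2" "dist u xbar < s" "dist u xbar < \<rho>"
      using xu \<rho> by (auto simp: r_def dist_commute)
    have "x \<in> U" "u \<in> W" using dx \<rho> by (auto simp: dist_commute subset_iff)
    have "H u \<in> V" using s(2)[OF dx(3)] \<sigma> by (auto simp: dist_commute subset_iff)
    have "dist (H x) (H u) < \<rho> / (4 * \<mu>) + \<rho> / (4 * \<mu>)"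
      using s(2)[OF dx(1)] s(2)[OF dx(3)] dist_triangle2[of "H x" "H u" "H xbar"] by linarith
    also have "\<dots> = \<rho> / (2 * \<mu>)" using \<mu> by (simp add: field_simps)
    finally have small: "\<mu> * norm (H x - H u) < \<rho> / 2"
      using \<mu> by (simp add: dist_norm field_simps)
    show ?thesis
    proof (rule field_le_epsilon)
      fix e :: real assume "e > 0"
      define e' where "e' = min e (\<rho> / 2 - \<mu> * norm (H x - H u))"
      have "e' > 0" using small \<open>e > 0\<close> by (simp add: e'_def)
      have "set_dist x (H -` {H u}) \<le> ereal (\<mu> * norm (H u - H x))"
        using reg \<open>x \<in> U\<close> \<open>H u \<in> V\<close> by blast
      also have "\<dots> < ereal (\<mu> * norm (H x - H u) + e')"
        using \<open>e' > 0\<close> by (simp add: norm_minus_commute)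
      finally obtain u' where u': "H u' = H u" "dist x u' < \<mu> * norm (H x - H u) + e'"
        unfolding set_dist_def INF_less_iff by auto
      then have "dist x u' < \<rho> / 2" unfolding e'_def by linarith
      then have "dist xbar u' < \<rho>"
        using dx(2) dist_triangle[of xbar u' x] by (simp add: dist_commute)
      then have "u' \<in> W" using \<rho> by (auto simp: subset_iff)
      then have "u' = u" using W(3) u'(1) \<open>u \<in> W\<close> by (meson inj_onD)
      then show "norm (x - u) \<le> \<mu> * norm (H x - H u) + e"
        using u'(2) by (simp add: dist_norm e'_def)
    qed
  qed
  moreover have "r > 0" using s \<rho> by (simp add: r_def)
  ultimately show ?thesis using \<mu> by blast
qed

lemma regular_subdifferentialI:
  assumes "\<And>e. e > 0 \<Longrightarrow> \<forall>\<^sub>F w in at v. p \<bullet> (w - v) - e * norm (w - v) \<le> f w - f v"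
  shows "p \<in> regular_subdifferential f v"
  unfolding regular_subdifferential_def mem_Collect_eq le_Liminf_iff
proof (intro allI impI)
  fix y :: ereal assume "y < 0"
  then obtain s where "y < ereal s" "s < 0"
    using ereal_dense2[of y 0] by auto
  then obtain e where e: "e > 0" "y < ereal (- e)"
    by (metis minus_minus neg_0_less_iff_less)
  show "\<forall>\<^sub>F w in at v. y < ereal ((f w - f v - p \<bullet> (w - v)) / norm (w - v))"
    using assms[OF e(1)] eventually_neq_at_within[of v v UNIV]
  proof eventually_elim
    case (elim w)
    then have "- e \<le> (f w - f v - p \<bullet> (w - v)) / norm (w - v)"
      by (simp add: pos_le_divide_eq)
    then show ?case using e(2) by (meson ereal_less_eq(3) less_le_trans)
  qed
qed

text \<open>If \<open>f\<close> decreases from \<open>u\<close> at rate at most \<open>c\<close>, then adding the penalty \<open>K * norm (v - u) ^ 2\<close> with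
  \<open>K = 2 * c / \<rho>\<close> forces the minimiser over the ball into its interior, and the negative
  gradient of the penalty there is a regular subgradient of \<open>f\<close>. Smoothness of the penalty is
  what makes an exact subgradient at a nearby point out of approximate minimality at \<open>u\<close>.\<close>

lemma ex_regular_subgradient_near_approximate_minimizer:
  fixes f :: "'a::euclidean_space \<Rightarrow> real"
  assumes "\<rho> > 0" "c > 0" and cont: "continuous_on (cball u \<rho>) f"
    and low: "\<And>v. v \<in> cball u \<rho> \<Longrightarrow> f u - c * norm (v - u) \<le> f v"
  shows "\<exists>v\<in>ball u \<rho>. \<exists>p\<in>regular_subdifferential f v. norm p \<le> 2 * c"
proof -
  define K where "K = 2 * c / \<rho>"
  have "K > 0" using assms by (simp add: K_def)
  have "\<exists>v\<in>cball u \<rho>. \<forall>w\<in>cball u \<rho>. f v + K * norm (v - u)^2 \<le> f w + K * norm (w - u)^2"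
    using \<open>\<rho> > 0\<close> by (intro continuous_attains_inf continuous_intros cont) auto
  then obtain v where v: "v \<in> cball u \<rho>"
    and min: "\<And>w. w \<in> cball u \<rho> \<Longrightarrow> f v + K * norm (v - u)^2 \<le> f w + K * norm (w - u)^2"
    by blast
  have "K * norm (v - u)^2 \<le> c * norm (v - u)"
    using min[of u] low[OF v] \<open>\<rho> > 0\<close> by simp
  then have Kv: "K * norm (v - u) \<le> c"
    using assms(2) by (cases "v = u") (auto simp: power2_eq_square mult.assoc[symmetric])
  then have "norm (v - u) \<le> \<rho> / 2"
    using assms by (simp add: K_def field_simps)
  then have vb: "v \<in> ball u \<rho>" using \<open>\<rho> > 0\<close> by (simp add: dist_norm norm_minus_commute)
  define p where "p = - (2 * K) *\<^sub>R (v - u)"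
  have "p \<in> regular_subdifferential f v"
  proof (rule regular_subdifferentialI)
    fix e :: real assume "e > 0"
    have "\<forall>\<^sub>F w in at v. w \<in> ball u \<rho>"
      using vb by (metis eventually_at_topological open_ball)
    moreover have "\<forall>\<^sub>F w in at v. dist w v < e / K"
      using \<open>e > 0\<close> \<open>K > 0\<close> by (auto simp: eventually_at intro!: exI[of _ "e / K"])
    ultimately show "\<forall>\<^sub>F w in at v. p \<bullet> (w - v) - e * norm (w - v) \<le> f w - f v"
    proof eventually_elim
      case (elim w)
      have "norm (w - u)^2 = norm ((w - v) + (v - u))^2" by simp
      also have "\<dots> = norm (w - v)^2 + 2 * ((v - u) \<bullet> (w - v)) + norm (v - u)^2"
        by (simp only: power2_norm_eq_inner inner_add_left inner_add_right inner_commute)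
      finally have "K * norm (w - u)^2 = K * norm (w - v)^2 + 2 * K * ((v - u) \<bullet> (w - v)) + K * norm (v - u)^2"
        by (simp only: distrib_left mult.assoc mult.left_commute)
      then have "K * norm (w - u)^2 = K * norm (w - v)^2 - p \<bullet> (w - v) + K * norm (v - u)^2"
        unfolding p_def inner_scaleR_left by linarith
      moreover have "K * norm (w - v) \<le> e"
        using elim(2) \<open>K > 0\<close> by (simp add: dist_norm field_simps)
      then have "K * norm (w - v)^2 \<le> e * norm (w - v)"
        by (metis mult.assoc mult_right_mono norm_ge_zero power2_eq_square)
      ultimately show ?case using min[of w] elim(1) by simp
    qed
  qed
  moreover have "norm p \<le> 2 * c" using Kv \<open>K > 0\<close> by (simp add: p_def)
  ultimately show ?thesis using vb by blast
qed

text \<open>A quantitative form of the differentiability of the norm away from \<open>0\<close>, with the remainder quadratic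
  in the increment; it follows from \<open>2 * norm a * norm (a + q) \<le> norm a ^ 2 + norm (a + q) ^ 2\<close>.\<close>

lemma norm_increment_le_inner:
  fixes a q :: "'a::real_inner"
  assumes "a \<noteq> 0"
  shows "norm (a + q) \<le> norm a + sgn a \<bullet> q + norm q ^ 2 / (2 * norm a)"
proof -
  have "0 \<le> (norm (a + q) - norm a)^2" by simp
  then have "2 * norm a * norm (a + q) \<le> norm (a + q)^2 + norm a ^ 2"
    by (simp add: power2_diff algebra_simps)
  also have "norm (a + q)^2 = norm a ^ 2 + 2 * (a \<bullet> q) + norm q ^ 2"
    by (simp only: power2_norm_eq_inner inner_add_left inner_add_right inner_commute)
  finally have "norm (a + q) \<le> (2 * norm a ^ 2 + 2 * (a \<bullet> q) + norm q ^ 2) / (2 * norm a)"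
    using assms by (simp add: pos_le_divide_eq mult.commute)
  also have "\<dots> = norm a + sgn a \<bullet> q + norm q ^ 2 / (2 * norm a)"
  proof -
    have "sgn a \<bullet> q = (a \<bullet> q) / norm a"
      by (simp add: sgn_div_norm divide_inverse mult.commute)
    moreover have "norm a > 0" using assms by simp
    ultimately show ?thesis by (simp add: field_simps power2_eq_square)
  qed
  finally show ?thesis .
qed

text \<open>If the expansion estimate with constant \<open>1 / c\<close> fails for \<open>x\<close> and \<open>u\<close>, then \<open>x\<close> is a better point than
  \<open>u\<close> for \<open>w \<mapsto> norm (H w - H u) + c * norm (w - x)\<close>. A minimiser \<open>v\<close> is thus different from
  \<open>u\<close>, so \<open>H v \<noteq> H u\<close> by injectivity and the norm is smooth at \<open>H v - H u\<close>; the unit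
  vector \<open>z\<close> is its gradient there. Minimality says that \<open>z \<bullet> H\<close> decreases from \<open>v\<close> at rate at most
  \<open>c\<close> to first order, and the quadratic error is absorbed into a second \<open>c\<close> by taking \<open>\<rho>\<close> small.\<close>

lemma ex_approximate_critical_direction:
  fixes H :: "'a::euclidean_space \<Rightarrow> 'b::real_inner"
  assumes lip: "L-lipschitz_on (cball xbar R) H" and inj: "inj_on H (cball xbar R)"
    and "0 < c" "0 < r" "3 * r \<le> R"
    and xu: "x \<in> ball xbar r" "u \<in> ball xbar r" "norm (H x - H u) < c * norm (x - u)"
  shows "\<exists>v z \<rho>. v \<in> ball xbar (3 * r) \<and> norm z = 1 \<and> 0 < \<rho> \<and> \<rho> \<le> r \<and> cball v \<rho> \<subseteq> cball xbar R \<and>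
           (\<forall>w\<in>cball v \<rho>. z \<bullet> H v - 2 * c * norm (w - v) \<le> z \<bullet> H w)"
proof -
  have L: "0 \<le> L" using lip by (rule lipschitz_on_nonneg)
  have cont: "continuous_on (cball xbar R) H" using lip by (rule lipschitz_on_continuous_on)
  have "\<exists>v\<in>cball xbar R. \<forall>w\<in>cball xbar R.
      norm (H v - H u) + c * norm (v - x) \<le> norm (H w - H u) + c * norm (w - x)"
    using assms(4,5) by (intro continuous_attains_inf continuous_intros cont) auto
  then obtain v where v: "v \<in> cball xbar R"
    and min: "\<And>w. w \<in> cball xbar R \<Longrightarrow>
      norm (H v - H u) + c * norm (v - x) \<le> norm (H w - H u) + c * norm (w - x)" by blast
  have xuR: "x \<in> cball xbar R" "u \<in> cball xbar R" using xu assms(4,5) by auto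
  have lt: "norm (H v - H u) + c * norm (v - x) < c * norm (x - u)"
    using min[OF xuR(1)] xu(3) by simp
  then have "v \<noteq> u" by (auto simp: norm_minus_commute)
  then have "H v \<noteq> H u" using inj v xuR by (meson inj_onD)
  define a where "a = H v - H u"
  have "a \<noteq> 0" using \<open>H v \<noteq> H u\<close> by (simp add: a_def)
  have "c * norm (v - x) < c * norm (x - u)" using lt norm_ge_zero[of "H v - H u"] by linarith
  then have "dist v x < dist x u" using \<open>c > 0\<close> by (simp add: dist_norm)
  moreover have "dist x u < 2 * r"
    using xu dist_triangle[of x u xbar] by (simp add: dist_commute)
  ultimately have v3: "dist xbar v < 3 * r"
    using xu(1) dist_triangle[of xbar v x] by (simp add: dist_commute)
  define \<rho> where "\<rho> = min (min r (3 * r - dist xbar v)) (2 * c * norm a / (L^2 + 1))"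
  have "L^2 + 1 > 0" by (simp add: add_nonneg_pos)
  have "\<rho> > 0" using v3 \<open>a \<noteq> 0\<close> \<open>c > 0\<close> \<open>r > 0\<close> \<open>L^2 + 1 > 0\<close> by (simp add: \<rho>_def)
  have sub: "cball v \<rho> \<subseteq> cball xbar R"
  proof
    fix w assume "w \<in> cball v \<rho>"
    then have "dist v w \<le> 3 * r - dist xbar v" by (simp add: \<rho>_def)
    then show "w \<in> cball xbar R" using dist_triangle[of xbar w v] assms(5) by simp
  qed
  have "sgn a \<bullet> H v - 2 * c * norm (w - v) \<le> sgn a \<bullet> H w" if w: "w \<in> cball v \<rho>" for w
  proof -
    define q where "q = H w - H v"
    \<comment> \<open>Minimality at \<open>v\<close>, with the centre of the penalty moved from \<open>x\<close> to \<open>v\<close> by the triangle inequality.\<close>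
    have "norm a \<le> norm (a + q) + c * norm (w - v)"
    proof -
      have "norm a + c * norm (v - x) \<le> norm (a + q) + c * norm (w - x)"
        using min[of w] w sub by (auto simp: a_def q_def)
      also have "c * norm (w - x) \<le> c * (norm (w - v) + norm (v - x))"
        using \<open>c > 0\<close> norm_triangle_ineq[of "w - v" "v - x"] by (intro mult_left_mono) auto
      finally show ?thesis by (simp add: algebra_simps)
    qed
    also have "\<dots> \<le> norm a + sgn a \<bullet> q + norm q ^ 2 / (2 * norm a) + c * norm (w - v)"
      using norm_increment_le_inner[OF \<open>a \<noteq> 0\<close>] by simp
    finally have 1: "0 \<le> sgn a \<bullet> q + norm q ^ 2 / (2 * norm a) + c * norm (w - v)" by simp
    have "norm q \<le> L * norm (w - v)"
      using lipschitz_onD[OF lip, of w v] w v sub by (auto simp: q_def dist_norm)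
    then have "norm q ^ 2 \<le> (L * norm (w - v))^2" by (intro power_mono) auto
    also have "\<dots> = (L^2 * norm (w - v)) * norm (w - v)" by (simp add: power2_eq_square)
    also have "\<dots> \<le> (2 * c * norm a) * norm (w - v)"
    proof (intro mult_right_mono)
      have "norm (w - v) \<le> 2 * c * norm a / (L^2 + 1)"
        using w by (simp add: \<rho>_def dist_norm norm_minus_commute)
      then have "norm (w - v) * (L^2 + 1) \<le> 2 * c * norm a"
        using \<open>L^2 + 1 > 0\<close> by (simp add: pos_le_divide_eq)
      moreover have "L^2 * norm (w - v) \<le> norm (w - v) * (L^2 + 1)" by (simp add: algebra_simps)
      ultimately show "L^2 * norm (w - v) \<le> 2 * c * norm a" by linarith
    qed simp
    finally have "norm q ^ 2 / (2 * norm a) \<le> c * norm (w - v)"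
      using \<open>a \<noteq> 0\<close> by (simp add: divide_le_eq mult_ac)
    with 1 have "0 \<le> sgn a \<bullet> q + 2 * c * norm (w - v)" by simp
    then show ?thesis by (simp add: q_def inner_diff_right)
  qed
  moreover have "norm (sgn a) = 1" using \<open>a \<noteq> 0\<close> by (simp add: norm_sgn)
  moreover have "v \<in> ball xbar (3 * r)" using v3 by simp
  moreover have "\<rho> \<le> r" by (simp add: \<rho>_def)
  ultimately show ?thesis using \<open>\<rho> > 0\<close> sub by blast
qed

text \<open>Were the estimate false for every constant and radius, the two preceding minimisation arguments
  would apply with \<open>c\<close> tending to \<open>0\<close>. The unit vectors \<open>z k\<close> vary, whereas the limiting subdifferential
  concerns a single function; replacing \<open>z k\<close> by the limit \<open>z0\<close> of a subsequence costs only
  \<open>L * norm (z k - z0)\<close> in the rate of decrease.\<close>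

lemma locally_expanding_of_limiting_subdifferential:
  fixes H :: "'a::euclidean_space \<Rightarrow> 'b::euclidean_space"
  assumes "lipschitz_around H xbar" "one_to_one_around H xbar"
    and crit: "\<And>z. 0 \<in> limiting_subdifferential (\<lambda>x. z \<bullet> H x) xbar \<Longrightarrow> z = 0"
  shows "\<exists>r>0. \<exists>\<mu>>0. \<forall>x\<in>ball xbar r. \<forall>u\<in>ball xbar r. norm (x - u) \<le> \<mu> * norm (H x - H u)"
proof (rule ccontr)
  assume contra: "\<not> ?thesis"
  obtain U L where U: "open U" "xbar \<in> U" "L-lipschitz_on U H"
    using assms(1) unfolding lipschitz_around_def by blast
  obtain W where W: "open W" "xbar \<in> W" "inj_on H W"
    using assms(2) unfolding one_to_one_around_def by blast
  obtain R where R: "R > 0" "cball xbar R \<subseteq> U \<inter> W"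
    using U W open_contains_cball[of "U \<inter> W"] by (metis IntI open_Int)
  have lip: "L-lipschitz_on (cball xbar R) H" using R U(3) lipschitz_on_subset by blast
  have inj: "inj_on H (cball xbar R)" using R W(3) inj_on_subset by blast
  have L: "0 \<le> L" using lip by (rule lipschitz_on_nonneg)
  define c where "c k = inverse (real (Suc k))" for k
  have c: "c k > 0" "c k \<le> 1" for k by (auto simp: c_def divide_simps)
  have c0: "c \<longlonglongrightarrow> 0" unfolding c_def[abs_def] by (rule LIMSEQ_inverse_real_of_nat)
  have "\<exists>v z \<rho>. v \<in> ball xbar (R * c k) \<and> norm z = 1 \<and> 0 < \<rho> \<and> \<rho> \<le> R * c k \<and> cball v \<rho> \<subseteq> cball xbar R \<and>
           (\<forall>w\<in>cball v \<rho>. z \<bullet> H v - 2 * c k * norm (w - v) \<le> z \<bullet> H w)" for k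
  proof -
    have r: "R * c k / 3 > 0" "3 * (R * c k / 3) \<le> R"
      using R c[of k] by (auto simp: mult_left_le)
    then obtain x u where xu: "x \<in> ball xbar (R * c k / 3)" "u \<in> ball xbar (R * c k / 3)"
      "\<not> norm (x - u) \<le> inverse (c k) * norm (H x - H u)"
      using contra c(1)[of k] by (meson positive_imp_inverse_positive)
    then have "norm (H x - H u) < c k * norm (x - u)"
      using c(1)[of k] by (simp add: field_simps)
    from ex_approximate_critical_direction[OF lip inj c(1) r xu(1,2) this]
    obtain v z \<rho> where "v \<in> ball xbar (3 * (R * c k / 3))" "norm z = 1" "0 < \<rho>" "\<rho> \<le> R * c k / 3"
      "cball v \<rho> \<subseteq> cball xbar R" "\<And>w. w \<in> cball v \<rho> \<Longrightarrow> z \<bullet> H v - 2 * c k * norm (w - v) \<le> z \<bullet> H w"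
      by blast
    then show ?thesis
      using r(1) by (intro exI[of _ v] exI[of _ z] exI[of _ \<rho>]) auto
  qed
  then obtain v z \<rho> where vz: "\<And>k. v k \<in> ball xbar (R * c k)" "\<And>k. norm (z k) = 1"
    "\<And>k. 0 < \<rho> k" "\<And>k. \<rho> k \<le> R * c k" "\<And>k. cball (v k) (\<rho> k) \<subseteq> cball xbar R"
    "\<And>k w. w \<in> cball (v k) (\<rho> k) \<Longrightarrow> z k \<bullet> H (v k) - 2 * c k * norm (w - v k) \<le> z k \<bullet> H w"
    by metis
  have "\<And>k. z k \<in> sphere 0 1" using vz(2) by simp
  then obtain z0 s where s: "z0 \<in> sphere 0 1" "strict_mono s" "(z \<circ> s) \<longlonglongrightarrow> z0"
    using compact_sphere[of "0::'b" 1] unfolding compact_def by metis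
  define C where "C k = 2 * c k + L * norm (z k - z0)" for k
  have "\<exists>x p. x \<in> ball (v k) (\<rho> k) \<and> p \<in> regular_subdifferential (\<lambda>x. z0 \<bullet> H x) x \<and> norm p \<le> 2 * C k" for k
  proof -
    have low: "z0 \<bullet> H (v k) - C k * norm (w - v k) \<le> z0 \<bullet> H w" if w: "w \<in> cball (v k) (\<rho> k)" for w
    proof -
      have vk: "v k \<in> cball (v k) (\<rho> k)" using vz(3)[of k] by simp
      have "(z k - z0) \<bullet> (H w - H (v k)) \<le> norm (z k - z0) * norm (H w - H (v k))"
        by (rule norm_cauchy_schwarz)
      also have "\<dots> \<le> norm (z k - z0) * (L * norm (w - v k))"
        using lipschitz_onD[OF lip subsetD[OF vz(5) w] subsetD[OF vz(5) vk]]
        by (intro mult_left_mono) (auto simp: dist_norm)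
      finally have "(z k - z0) \<bullet> (H w - H (v k)) \<le> L * norm (z k - z0) * norm (w - v k)"
        by (simp add: mult_ac)
      with vz(6)[OF w] show ?thesis
        by (simp add: C_def inner_diff_left inner_diff_right algebra_simps)
    qed
    have cont: "continuous_on (cball (v k) (\<rho> k)) (\<lambda>x. z0 \<bullet> H x)"
      by (intro continuous_intros continuous_on_subset[OF lipschitz_on_continuous_on[OF lip] vz(5)])
    have "C k > 0" using c[of k] L by (simp add: C_def add_pos_nonneg)
    then show ?thesis
      using ex_regular_subgradient_near_approximate_minimizer[OF vz(3) _ cont low] by blast
  qed
  then obtain X P where XP: "\<And>k. X k \<in> ball (v k) (\<rho> k)"
    "\<And>k. P k \<in> regular_subdifferential (\<lambda>x. z0 \<bullet> H x) (X k)" "\<And>k. norm (P k) \<le> 2 * C k"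
    by metis
  have X: "X \<longlonglongrightarrow> xbar"
  proof (rule metric_tendsto_imp_tendsto)
    have "(\<lambda>k. 2 * R * c k) \<longlonglongrightarrow> 2 * R * 0" by (intro tendsto_intros c0)
    then show "(\<lambda>k. 2 * R * c k) \<longlonglongrightarrow> 0" by simp
    have "dist (X k) xbar \<le> 2 * R * c k" for k
      using XP(1)[of k] vz(1)[of k] vz(4)[of k] dist_triangle[of xbar "X k" "v k"]
      unfolding mem_ball dist_commute[of _ xbar] by linarith
    then show "\<forall>\<^sub>F k in sequentially. dist (X k) xbar \<le> dist (2 * R * c k) 0"
      by (intro always_eventually allI) (simp add: dist_real_def order_trans[OF _ abs_ge_self])
  qed
  have "(\<lambda>k. 2 * C (s k)) \<longlonglongrightarrow> 2 * (2 * 0 + L * norm (z0 - z0))"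
    unfolding C_def using s(3) LIMSEQ_subseq_LIMSEQ[OF c0 s(2)]
    by (intro tendsto_intros) (simp_all add: o_def)
  then have "(\<lambda>k. 2 * C (s k)) \<longlonglongrightarrow> 0" by simp
  then have "(P \<circ> s) \<longlonglongrightarrow> 0"
    by (rule Lim_null_comparison[rotated]) (use XP(3) in \<open>auto intro: always_eventually\<close>)
  moreover have "(X \<circ> s) \<longlonglongrightarrow> xbar" using X s(2) by (rule LIMSEQ_subseq_LIMSEQ)
  ultimately have "0 \<in> limiting_subdifferential (\<lambda>x. z0 \<bullet> H x) xbar"
    unfolding limiting_subdifferential_def mem_Collect_eq
    using XP(2) by (intro exI[of _ "X \<circ> s"] exI[of _ "P \<circ> s"]) auto
  then have "z0 = 0" by (rule crit)
  then show False using s(1) by simp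
qed

section \<open>Solvability of the Newton equation\<close>

text \<open>The expansion estimate for \<open>H\<close> passes to its one-sided derivatives. In particular a direction with
  a prescribed derivative is unique.\<close>

lemma has_dir_deriv_expanding:
  assumes S: "open S" "x \<in> S"
    and exp: "\<And>x u. x \<in> S \<Longrightarrow> u \<in> S \<Longrightarrow> norm (x - u) \<le> \<mu> * norm (H x - H u)"
    and "has_dir_deriv H x d v" "has_dir_deriv H x e w"
  shows "norm (d - e) \<le> \<mu> * norm (v - w)"
proof (rule tendsto_lowerbound)
  show "((\<lambda>t. \<mu> * norm ((H (x + t *\<^sub>R d) - H x) /\<^sub>R t - (H (x + t *\<^sub>R e) - H x) /\<^sub>R t)) \<longlongrightarrow> \<mu> * norm (v - w)) (at_right 0)"
    using assms(4,5) unfolding has_dir_deriv_def by (intro tendsto_intros)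
  show "\<forall>\<^sub>F t in at_right 0. norm (d - e)
      \<le> \<mu> * norm ((H (x + t *\<^sub>R d) - H x) /\<^sub>R t - (H (x + t *\<^sub>R e) - H x) /\<^sub>R t)"
    using eventually_in_open_at_right[OF S, of d] eventually_in_open_at_right[OF S, of e]
      eventually_at_right_less[of 0]
  proof eventually_elim
    case (elim t)
    have "(H (x + t *\<^sub>R d) - H x) /\<^sub>R t - (H (x + t *\<^sub>R e) - H x) /\<^sub>R t
        = (H (x + t *\<^sub>R d) - H (x + t *\<^sub>R e)) /\<^sub>R t"
      by (simp add: algebra_simps)
    then have "norm ((H (x + t *\<^sub>R d) - H x) /\<^sub>R t - (H (x + t *\<^sub>R e) - H x) /\<^sub>R t)
        = norm (H (x + t *\<^sub>R d) - H (x + t *\<^sub>R e)) / t"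
      using elim by (simp add: divide_inverse mult.commute)
    moreover have "t * norm (d - e) \<le> \<mu> * norm (H (x + t *\<^sub>R d) - H (x + t *\<^sub>R e))"
      using exp[OF elim(1,2)] elim(3) by (simp flip: scaleR_diff_right)
    ultimately show ?case using elim(3) by (simp add: pos_le_divide_eq mult.commute)
  qed
qed simp

text \<open>The derivative is surjective in the direction: since \<open>H\<close> is open, \<open>H x + t *\<^sub>R v\<close> has a preimage
  \<open>x + t *\<^sub>R d\<close> for small \<open>t\<close>; since \<open>H\<close> is expanding, these \<open>d\<close> stay bounded; and since \<open>H\<close> is
  Lipschitz, a cluster point of them as \<open>t\<close> tends to \<open>0\<close> has derivative \<open>v\<close>.\<close>

lemma ex_has_dir_deriv_eq:
  fixes H :: "'a::euclidean_space \<Rightarrow> 'a"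
  assumes S: "open S" "x \<in> S" "L-lipschitz_on S H"
    and exp: "\<And>x u. x \<in> S \<Longrightarrow> u \<in> S \<Longrightarrow> norm (x - u) \<le> \<mu> * norm (H x - H u)"
    and dir: "\<And>d. \<exists>v. has_dir_deriv H x d v"
  shows "\<exists>d. has_dir_deriv H x d v"
proof -
  have "inj_on H S"
    using exp by (intro inj_onI) fastforce
  then have "open (H ` S)"
    using invariance_of_domain lipschitz_on_continuous_on[OF S(3)] S(1) by blast
  then obtain \<rho> where \<rho>: "\<rho> > 0" "ball (H x) \<rho> \<subseteq> H ` S"
    using S(2) by (meson imageI openE)
  have v1: "norm v + 1 > 0" by (simp add: add_nonneg_pos)
  define t where "t k = \<rho> / (norm v + 1) / real (Suc k)" for k
  have t_pos: "t k > 0" for k using \<rho> v1 by (simp add: t_def)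
  have t0: "t \<longlonglongrightarrow> 0"
    unfolding t_def[abs_def] using LIMSEQ_Suc[OF lim_const_over_n[of "\<rho> / (norm v + 1)"]] by simp
  have "\<exists>u\<in>S. H u = H x + t k *\<^sub>R v" for k
  proof -
    have "t k \<le> \<rho> / (norm v + 1)"
      using \<rho> v1 by (simp add: t_def divide_le_eq mult_left_le)
    then have "t k * (norm v + 1) \<le> \<rho>" using v1 by (simp add: pos_le_divide_eq)
    then have "norm (t k *\<^sub>R v) < \<rho>" using t_pos[of k] by (simp add: algebra_simps)
    then have "H x + t k *\<^sub>R v \<in> ball (H x) \<rho>" by (simp add: dist_norm)
    then show ?thesis using \<rho>(2) by force
  qed
  then obtain u where u: "\<And>k. u k \<in> S" "\<And>k. H (u k) = H x + t k *\<^sub>R v" by metis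
  define d where "d k = (u k - x) /\<^sub>R t k" for k
  have u_eq: "u k = x + t k *\<^sub>R d k" for k using t_pos[of k] by (simp add: d_def)
  have "d k \<in> cball 0 (\<mu> * norm v)" for k
  proof -
    have "t k * norm (d k) \<le> \<mu> * (t k * norm v)"
      using exp[OF u(1) S(2), of k] u(2)[of k] t_pos[of k] by (simp add: u_eq)
    then show ?thesis using t_pos[of k] by (simp add: mult.left_commute)
  qed
  then obtain e s where s: "strict_mono s" "(d \<circ> s) \<longlonglongrightarrow> e"
    using compact_cball[of "0::'a" "\<mu> * norm v"] unfolding compact_def by metis
  obtain w where w: "has_dir_deriv H x e w" using dir by blast
  have "(\<lambda>k. (H (x + (t \<circ> s) k *\<^sub>R (d \<circ> s) k) - H x) /\<^sub>R (t \<circ> s) k) \<longlonglongrightarrow> w"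
    by (rule has_dir_deriv_sequentially_variable_direction[OF S w])
      (use t_pos s(2) LIMSEQ_subseq_LIMSEQ[OF t0 s(1)] in \<open>simp_all del: o_apply, simp\<close>)
  moreover have "(H (x + (t \<circ> s) k *\<^sub>R (d \<circ> s) k) - H x) /\<^sub>R (t \<circ> s) k = v" for k
    using u(2)[of "s k"] t_pos[of "s k"] by (simp add: u_eq)
  ultimately have "w = v" by (simp add: LIMSEQ_const_iff)
  then show ?thesis using w by blast
qed

section \<open>Convergence of the iteration\<close>

text \<open>The abstract convergence argument: if one step has error at most \<open>\<mu> * \<phi> x\<close> and
  \<open>\<phi> x = o(norm (x - xbar))\<close>, then near \<open>xbar\<close> steps contract by any prescribed factor. The factor
  \<open>1 / 2\<close> keeps the iterates in a ball and makes them converge; an arbitrary factor then gives the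
  superlinear rate.\<close>

lemma newton_method_converges:
  fixes H :: "'a::real_normed_vector \<Rightarrow> 'a"
  assumes "R > 0" "\<mu> > 0"
    and solvable: "\<And>x. x \<in> ball xbar R \<Longrightarrow> \<exists>d. newton_direction H x d"
    and step: "\<And>x d. x \<in> ball xbar R \<Longrightarrow> newton_direction H x d \<Longrightarrow> norm (x + d - xbar) \<le> \<mu> * \<phi> x"
    and remainder: "\<And>\<epsilon>. \<epsilon> > 0 \<Longrightarrow> \<exists>\<delta>>0. \<forall>x\<in>ball xbar \<delta>. \<phi> x \<le> \<epsilon> * norm (x - xbar)"
  shows "\<exists>\<delta>>0. \<forall>x0\<in>ball xbar \<delta>. newton_well_defined H x0 \<and>
           (\<forall>x. newton_sequence H x0 x \<longrightarrow> converges_superlinearly x xbar)"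
proof -
  have contract: "\<exists>\<delta>>0. \<forall>x\<in>ball xbar \<delta>. \<forall>x'. newton_step H x x' \<longrightarrow> norm (x' - xbar) \<le> q * norm (x - xbar)"
    if q: "q > 0" for q
  proof -
    obtain \<delta> where \<delta>: "\<delta> > 0" "\<And>x. x \<in> ball xbar \<delta> \<Longrightarrow> \<phi> x \<le> (q / \<mu>) * norm (x - xbar)"
      using remainder[OF divide_pos_pos[OF q \<open>\<mu> > 0\<close>]] by blast
    have "norm (x' - xbar) \<le> q * norm (x - xbar)" if x: "x \<in> ball xbar (min \<delta> R)" and "newton_step H x x'" for x x'
    proof -
      obtain d where "newton_direction H x d" "x' = x + d"
        using \<open>newton_step H x x'\<close> unfolding newton_step_def by blast
      then have "norm (x' - xbar) \<le> \<mu> * \<phi> x" using step x by simp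
      also have "\<dots> \<le> \<mu> * ((q / \<mu>) * norm (x - xbar))"
        using \<delta>(2)[of x] x \<open>\<mu> > 0\<close> by (intro mult_left_mono) auto
      finally show ?thesis using \<open>\<mu> > 0\<close> by simp
    qed
    then show ?thesis using \<delta>(1) \<open>R > 0\<close> by (intro exI[of _ "min \<delta> R"]) auto
  qed
  obtain \<delta>' where \<delta>': "\<delta>' > 0"
    "\<And>x x'. x \<in> ball xbar \<delta>' \<Longrightarrow> newton_step H x x' \<Longrightarrow> norm (x' - xbar) \<le> 1 / 2 * norm (x - xbar)"
    using contract[of "1 / 2"] by auto
  define \<delta> where "\<delta> = min \<delta>' R"
  have "\<delta> > 0" using \<delta>'(1) \<open>R > 0\<close> by (simp add: \<delta>_def)
  have half: "norm (x' - xbar) \<le> 1 / 2 * norm (x - xbar)" if "x \<in> ball xbar \<delta>" "newton_step H x x'" for x x'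
    using \<delta>'(2)[of x x'] that by (simp add: \<delta>_def)
  have stay: "x' \<in> ball xbar \<delta>" if "x \<in> ball xbar \<delta>" "newton_step H x x'" for x x'
  proof -
    have "norm (x' - xbar) \<le> norm (x - xbar)"
      using half[OF that] norm_ge_zero[of "x - xbar"] by linarith
    then show ?thesis using that(1) by (simp add: dist_norm norm_minus_commute)
  qed
  have "newton_well_defined H x0" if "x0 \<in> ball xbar \<delta>" for x0
    unfolding newton_well_defined_def
  proof (intro allI impI)
    fix x assume "(newton_step H)\<^sup>*\<^sup>* x0 x"
    then have "x \<in> ball xbar \<delta>"
      by (induction rule: rtranclp_induct) (use that stay in blast)+
    then show "\<exists>d. newton_direction H x d" by (intro solvable) (simp add: \<delta>_def)
  qed
  moreover have "converges_superlinearly x xbar" if x0: "x0 \<in> ball xbar \<delta>" and x: "newton_sequence H x0 x" for x0 x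
    unfolding converges_superlinearly_def
  proof
    have xstep: "newton_step H (x k) (x (Suc k))" "x 0 = x0" for k
      using x by (auto simp: newton_sequence_def)
    have xball: "x k \<in> ball xbar \<delta>" for k
      by (induction k) (use x0 xstep stay in auto)
    have "norm (x k - xbar) \<le> (1 / 2) ^ k * norm (x0 - xbar)" for k
    proof (induction k)
      case (Suc k)
      then show ?case using half[OF xball xstep(1), of k] by simp
    qed (simp add: xstep)
    moreover have "(\<lambda>k. (1 / 2) ^ k * norm (x0 - xbar)) \<longlonglongrightarrow> 0"
      by (intro tendsto_mult_left_zero LIMSEQ_realpow_zero) auto
    ultimately have "(\<lambda>k. x k - xbar) \<longlonglongrightarrow> 0"
      by (intro Lim_null_comparison[of "\<lambda>k. x k - xbar"]) (auto intro: always_eventually)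
    then show lim: "x \<longlonglongrightarrow> xbar" by (simp add: LIM_zero_iff)
    show "(\<lambda>k. norm (x (Suc k) - xbar)) \<in> o(\<lambda>k. norm (x k - xbar))"
    proof (rule landau_o.smallI)
      fix q :: real assume "q > 0"
      then obtain \<delta>2 where \<delta>2: "\<delta>2 > 0"
        "\<And>x x'. x \<in> ball xbar \<delta>2 \<Longrightarrow> newton_step H x x' \<Longrightarrow> norm (x' - xbar) \<le> q * norm (x - xbar)"
        using contract by meson
      have "\<forall>\<^sub>F k in sequentially. x k \<in> ball xbar \<delta>2"
        using lim \<delta>2(1) by (intro topological_tendstoD) auto
      then show "\<forall>\<^sub>F k in sequentially. norm (norm (x (Suc k) - xbar)) \<le> q * norm (norm (x k - xbar))"
        by eventually_elim (use \<delta>2(2) xstep(1) in simp)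
    qed
  qed
  ultimately show ?thesis using \<open>\<delta> > 0\<close> by blast
qed

theorem theorem5p1:
  fixes H :: "real^'n \<Rightarrow> real^'n" and xbar :: "real^'n"
  assumes "H xbar = 0"
    and "lipschitz_around H xbar"
    and "dir_differentiable_around H xbar"
    and "semismooth_at H xbar"
    and "one_to_one_around H xbar"
    and "metrically_regular_around H xbar \<or>
         (\<forall>z. 0 \<in> limiting_subdifferential (\<lambda>x. z \<bullet> H x) xbar \<longrightarrow> z = 0)"
  shows "\<exists>\<delta>>0. \<forall>x0\<in>ball xbar \<delta>.
           newton_well_defined H x0 \<and>
           (\<forall>x. newton_sequence H x0 x \<longrightarrow> converges_superlinearly x xbar)"
proof -
  obtain U1 L where U1: "open U1" "xbar \<in> U1" "L-lipschitz_on U1 H"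
    using assms(2) unfolding lipschitz_around_def by blast
  obtain U2 where U2: "open U2" "xbar \<in> U2" "\<And>x d. x \<in> U2 \<Longrightarrow> \<exists>v. has_dir_deriv H x d v"
    using assms(3) unfolding dir_differentiable_around_def by blast
  have "isCont H xbar"
    using lipschitz_on_continuous_on[OF U1(3)] U1(1,2) continuous_on_eq_continuous_at by blast
  then have "\<exists>r>0. \<exists>\<mu>>0. \<forall>x\<in>ball xbar r. \<forall>u\<in>ball xbar r. norm (x - u) \<le> \<mu> * norm (H x - H u)"
    using assms(6) locally_expanding_of_metrically_regular[OF _ assms(5)]
      locally_expanding_of_limiting_subdifferential[OF assms(2,5)] by blast
  then obtain r \<mu> where r: "r > 0" and \<mu>: "\<mu> > 0"
    and exp: "\<And>x u. x \<in> ball xbar r \<Longrightarrow> u \<in> ball xbar r \<Longrightarrow> norm (x - u) \<le> \<mu> * norm (H x - H u)"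
    by blast
  have "open (U1 \<inter> U2 \<inter> ball xbar r)" "xbar \<in> U1 \<inter> U2 \<inter> ball xbar r"
    using U1 U2 r by auto
  then obtain R where R: "R > 0" "ball xbar R \<subseteq> U1 \<inter> U2 \<inter> ball xbar r"
    by (meson openE)
  let ?S = "ball xbar R"
  have lip: "L-lipschitz_on ?S H" using R(2) U1(3) lipschitz_on_subset by blast
  have expS: "norm (x - u) \<le> \<mu> * norm (H x - H u)" if "x \<in> ?S" "u \<in> ?S" for x u
    using exp that R(2) by blast
  have dir: "\<exists>v. has_dir_deriv H x d v" if "x \<in> ?S" for x d
    using U2(3) that R(2) by blast
  then obtain D where D: "\<And>x d. x \<in> ?S \<Longrightarrow> has_dir_deriv H x d (D x d)"
    by metis
  show ?thesis
  proof (rule newton_method_converges[OF R(1) \<mu>])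
    show "\<exists>d. newton_direction H x d" if "x \<in> ?S" for x
      unfolding newton_direction_def
      using ex_has_dir_deriv_eq[OF open_ball that lip expS dir[OF that]] by blast
    show "norm (x + d - xbar) \<le> \<mu> * norm (H x - H xbar + D x (xbar - x))"
      if x: "x \<in> ?S" and d: "newton_direction H x d" for x d
    proof -
      have "norm (d - (xbar - x)) \<le> \<mu> * norm (- H x - D x (xbar - x))"
        using has_dir_deriv_expanding[OF open_ball x expS d[unfolded newton_direction_def] D[OF x]] .
      moreover have "- H x - D x (xbar - x) = - (H x - H xbar + D x (xbar - x))"
        using assms(1) by simp
      ultimately show ?thesis
        by (simp only: norm_minus_cancel) (simp add: algebra_simps)
    qed
    show "\<exists>\<delta>>0. \<forall>x\<in>ball xbar \<delta>. norm (H x - H xbar + D x (xbar - x)) \<le> \<epsilon> * norm (x - xbar)"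
      if "\<epsilon> > 0" for \<epsilon>
      using semismooth_newton_remainder[OF open_ball _ lip D assms(4) that] R(1) by simp
  qed
qed

end
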